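(* Let $1\le r<N/2$ and let $\mathsf S\in\mathcal D_r$ be governed by the GLRR($\mathbf a$), $\mathbf a\in\mathbb R^{r+1}$, $\mathbf a\ne\mathbf 0$. Then the tangent subspace to $\mathcal D_r$ at the point $\mathsf S$ has dimension $2r$ and is equal to $\mathcal Z(\mathbf a^2)$.
   Context: Time series of length $N$ are vectors in $\mathbb R^N$. For $1\le L\le N$, $T_L:\mathbb R^N\to\mathbb R^{L\times(N-L+1)}$ maps $\mathsf S=(s_1,\dots,s_N)^{\mathrm T}$ to the Hankel matrix with $(i,j)$ entry $s_{i+j-1}$. For $r<N/2$, $\mathcal D_r=\{\mathsf S\in\mathbb R^N:\operatorname{rank}T_{r+1}(\mathsf S)=r\}$. For nonzero $\mathbf b\in\mathbb R^{m+1}$, $\mathsf S$ is governed by GLRR($\mathbf b$) if $\mathbf b^{\mathrm T}T_{m+1}(\mathsf S)=\mathbf 0^{\mathrm T}_{N-m}$, and $\mathcal Z(\mathbf b)\subset\mathbb R^N$ is the space of all series of length $N$ governed by GLRR($\mathbf b$). For $\mathbf a\in\mathbb R^{r+1}$, $\mathbf a^2=(a^{(2)}_i)\in\mathbb R^{2r+1}$ is the acyclic convolution of $\mathbf a$ with itself: $a^{(2)}_i=\sum_{j=\max(1,i-r)}^{\min(i,r+1)}a_ja_{i-j+1}$. Tangent subspace: multiplying $\mathbf a$ by a nonzero constant does not change the GLRR, so choose $\tau\in\{1,\dots,r+1\}$ with $a_\tau\neq0$ and normalize $a_\tau=-1$. Let $\mathcal I(\tau)=\{1,\dots,N\}\setminus\{\tau,\dots,N-r-1+\tau\}$,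 $\mathcal K(\tau)=\{1,\dots,r+1\}\setminus\{\tau\}$; subscripts $\mathcal I(\tau)$, $\mathcal K(\tau)$ denote subvectors; $H_\tau:\mathbb R^r\to\mathbb R^{r+1}$ inserts $-1$ at position $\tau$. The set $\mathcal D_r$ near $\mathsf S$ is smoothly parameterized by the local diffeomorphism $S_\tau$, where for $(\dot{\mathbf s},\dot{\mathbf a})\in\mathbb R^{r}\times\mathbb R^r$ close to $(\mathsf S_{\mathcal I(\tau)},\mathbf a_{\mathcal K(\tau)})$, $S_\tau(\dot{\mathbf s},\dot{\mathbf a})$ is the unique series in $\mathcal D_r$ that is governed by GLRR($H_\tau(\dot{\mathbf a})$) and whose entries with indices in $\mathcal I(\tau)$ form $\dot{\mathbf s}$. The tangent subspace to $\mathcal D_r$ at $\mathsf S$ is by definition the column space of the $N\times 2r$ Jacobian matrix of $S_\tau$ at $(\mathsf S_{\mathcal I(\tau)},\mathbf a_{\mathcal K(\tau)})$; it does not depend on the choice of parameterization. *)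

theory Defs
  imports Complex_Main "Jordan_Normal_Form.DL_Rank" "Jordan_Normal_Form.DL_Submatrix"
begin

text \<open>
  Time series of length \<open>N\<close> are elements of \<open>carrier_vec N\<close>. All indices start at \<open>0\<close>.
\<close>

definition hankel :: "nat \<Rightarrow> real vec \<Rightarrow> real mat" where
  "hankel L S = mat L (dim_vec S - L + 1) (\<lambda>(i, j). S $ (i + j))"

definition rank_series :: "nat \<Rightarrow> nat \<Rightarrow> real vec set" where
  "rank_series N r = {S \<in> carrier_vec N. vec_space.rank (r + 1) (hankel (r + 1) S) = r}"

text \<open>
  \<open>governed b S\<close> is \<open>b\<^sup>T T\<^bsub>m+1\<^esub>(S) = 0\<close>, transposed, for \<open>b\<close> with \<open>m + 1\<close> entries;
  it is only meaningful for \<open>b \<noteq> 0\<close> and \<open>dim_vec b \<le> dim_vec S\<close>.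
\<close>

definition governed :: "real vec \<Rightarrow> real vec \<Rightarrow> bool" where
  "governed b S \<longleftrightarrow>
     transpose_mat (hankel (dim_vec b) S) *\<^sub>v b = 0\<^sub>v (dim_vec S - dim_vec b + 1)"

definition glrr_space :: "nat \<Rightarrow> real vec \<Rightarrow> real vec set" where
  "glrr_space N b = {S \<in> carrier_vec N. governed b S}"

text \<open>
  With truncated subtraction, \<open>i - r\<close> is \<open>max 0 (i - r)\<close>.
\<close>

definition self_convolution :: "nat \<Rightarrow> real vec \<Rightarrow> real vec" where
  "self_convolution r a = vec (2 * r + 1) (\<lambda>i. \<Sum>j = i - r..min i r. a $ j * a $ (i - j))"

definition index_I :: "nat \<Rightarrow> nat \<Rightarrow> nat \<Rightarrow> nat set" where
  "index_I N r \<tau> = {0..<N} - {\<tau>..<N - r + \<tau>}"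

definition index_K :: "nat \<Rightarrow> nat \<Rightarrow> nat set" where
  "index_K r \<tau> = {0..<r + 1} - {\<tau>}"

definition subvec :: "real vec \<Rightarrow> nat set \<Rightarrow> real vec" where
  "subvec v I = vec (card I) (\<lambda>k. v $ pick I k)"

definition insert_minus1 :: "nat \<Rightarrow> nat \<Rightarrow> real vec \<Rightarrow> real vec" where
  "insert_minus1 r \<tau> x =
     vec (r + 1) (\<lambda>i. if i < \<tau> then x $ i else if i = \<tau> then -1 else x $ (i - 1))"

text \<open>
  A parameter point \<open>(s, a) \<in> \<real>\<^sup>r \<times> \<real>\<^sup>r\<close> is encoded as the concatenation \<open>s @\<^sub>v a\<close>, an
  element of \<open>carrier_vec (2 * r)\<close>.
\<close>

definition param_series :: "nat \<Rightarrow> nat \<Rightarrow> nat \<Rightarrow> real vec \<Rightarrow> real vec \<Rightarrow> bool" where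
  "param_series N r \<tau> x T \<longleftrightarrow>
     T \<in> rank_series N r \<and>
     governed (insert_minus1 r \<tau> (vec_last x r)) T \<and>
     subvec T (index_I N r \<tau>) = vec_first x r"

definition S_map :: "nat \<Rightarrow> nat \<Rightarrow> nat \<Rightarrow> real vec \<Rightarrow> real vec" where
  "S_map N r \<tau> x = (THE T. param_series N r \<tau> x T)"

text \<open>
  \<open>S_map N r \<tau>\<close> is well defined around \<open>x\<close>. This does not follow from \<open>a\<^sub>\<tau> = -1\<close> alone: for
  \<open>N = 7\<close>, \<open>r = 2\<close>, \<open>a = (1, -1, 1)\<close> and the middle index \<open>\<tau> = 1\<close>, every series governed by
  \<open>a\<close> has period 6, so its first and last entries agree and do not determine it. Taking for \<open>\<tau>\<close>
  the first or the last index with \<open>a\<^sub>\<tau> \<noteq> 0\<close> always works, because the linear system for the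
  remaining entries is then triangular.
\<close>

definition S_map_defined_near :: "nat \<Rightarrow> nat \<Rightarrow> nat \<Rightarrow> real vec \<Rightarrow> bool" where
  "S_map_defined_near N r \<tau> x \<longleftrightarrow>
     (\<exists>\<epsilon>>0. \<forall>y\<in>carrier_vec (2 * r).
        (\<forall>k<2 * r. \<bar>y $ k - x $ k\<bar> < \<epsilon>) \<longrightarrow> (\<exists>!T. param_series N r \<tau> y T))"

definition has_jacobian ::
  "nat \<Rightarrow> nat \<Rightarrow> (real vec \<Rightarrow> real vec) \<Rightarrow> real mat \<Rightarrow> real vec \<Rightarrow> bool" where
  "has_jacobian m n F J x \<longleftrightarrow>
     J \<in> carrier_mat m n \<and>
     (\<forall>i<m. \<forall>j<n.
        ((\<lambda>t. F (x + t \<cdot>\<^sub>v unit_vec n j) $ i) has_real_derivative J $$ (i, j)) (at 0))"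

text \<open>
  \<open>V\<close> is obtained as the tangent subspace to \<open>rank_series N r\<close> at \<open>S\<close> from one of the
  parameterizations \<open>S_map N r \<tau>\<close>. That all of them yield the same \<open>V\<close> is not presupposed.
\<close>

definition is_tangent_subspace :: "nat \<Rightarrow> nat \<Rightarrow> real vec \<Rightarrow> real vec set \<Rightarrow> bool" where
  "is_tangent_subspace N r S V \<longleftrightarrow>
     (\<exists>\<tau> a x J.
        \<tau> < r + 1 \<and> a \<in> carrier_vec (r + 1) \<and> a $ \<tau> = -1 \<and> governed a S \<and>
        x = subvec S (index_I N r \<tau>) @\<^sub>v subvec a (index_K r \<tau>) \<and>
        S_map_defined_near N r \<tau> x \<and>
        has_jacobian N (2 * r) (S_map N r \<tau>) J x \<and>
        V = vec_space.col_space N J)"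

definition subspace_dim :: "nat \<Rightarrow> real vec set \<Rightarrow> nat" where
  "subspace_dim N V = vectorspace.dim class_ring ((module_vec TYPE(real) N)\<lparr>carrier := V\<rparr>)"

end

(*
  Write a * T for the values of the recurrence a along T. Differentiating a(t) * T(t) = 0 along the
  parameterization gives a * T' = - a' * S; applying a once more and using a * S = 0 yields
  a^2 * T' = 0, so the tangent subspace lies in Z(a^2). If a combination of the columns of the
  Jacobian vanishes, its s-part is zero, hence a' * S = 0; as rank T_(r+1)(S) = r, a' is a multiple
  of a, and a'_tau = 0 makes it zero. So the dimension is 2r, and it cannot be smaller than that of
  Z(a^2), whose elements are determined by 2r suitable entries.

  For the existence of a tangent subspace take tau to be the last index with a_tau <> 0. The linear
  system for T is then uniquely solvable at the base point, hence nearby, and Cramer's rule shows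
  that its solution is differentiable. The rank stays r nearby because, for a nonzero b in the left
  kernel of the Hankel matrix, rank r means that some r columns bordered by b have nonzero
  determinant.
*)
theory Submission
  imports Defs
begin

text \<open>A tangent subspace may come from any \<open>\<tau>\<close> whose parameterization is
  well defined near the base point, whereas the existence argument covers only the last nonzero
  index. The two halves are therefore kept apart: the computation of the tangent subspace uses about
  \<open>S_map\<close> only the equations that hold near the base point and the partial derivatives
  collected in the Jacobian, and the explicit Cramer solution is confined to the existence half. For
  the same reason two indices occur in the computation: the parameterization has its own
  \<open>\<tau>\<close>, while elements of Z(a^2) are determined through the last nonzero index p of
  a, because 2p is then the last nonzero index of a^2.

  Among all series, having rank exactly r is neither an open nor a closed condition. Among series
  governed by some recurrence the rank is at most r anyway, so only the lower bound has to survive a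
  perturbation, and this is what a nonvanishing determinant can express.\<close>

section \<open>Matrix-vector products and invertible square systems\<close>

lemma mult_mat_vec_index_sum:
  assumes "A \<in> carrier_mat m n" and "v \<in> carrier_vec n" and "i < m"
  shows "(A *\<^sub>v v) $ i = (\<Sum>j<n. A $$ (i, j) * v $ j)"
  using assms by (auto simp: scalar_prod_def atLeast0LessThan intro!: sum.cong)

lemma det_nonzero_imp_solution:
  fixes A :: "'a :: field mat"
  assumes A: "A \<in> carrier_mat n n" and "det A \<noteq> 0" and w: "w \<in> carrier_vec n"
  obtains v where "v \<in> carrier_vec n" and "A *\<^sub>v v = w"
proof -
  from det_non_zero_imp_unit[OF A \<open>det A \<noteq> 0\<close>, of "()"]
  obtain B where B: "B \<in> carrier_mat n n" and AB: "A * B = 1\<^sub>m n"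
    by (auto simp: Units_def ring_mat_def)
  have "A *\<^sub>v (B *\<^sub>v w) = (A * B) *\<^sub>v w"
    using A B w by (simp add: assoc_mult_mat_vec)
  then have "A *\<^sub>v (B *\<^sub>v w) = w" using AB w by simp
  moreover have "B *\<^sub>v w \<in> carrier_vec n" using B w by auto
  ultimately show thesis using that by blast
qed

lemma det_nonzero_imp_zero:
  fixes A :: "'a :: field mat"
  assumes "A \<in> carrier_mat n n" and "det A \<noteq> 0" and "v \<in> carrier_vec n" and "A *\<^sub>v v = 0\<^sub>v n"
  shows "v = 0\<^sub>v n"
  using assms det_0_iff_vec_prod_zero_field by blast

section \<open>Rank, independent columns and trivial kernels\<close>

context vec_space
begin

text \<open>Independence concerns the set of columns, which hides repetitions, so distinctness is a
  separate claim: equal columns i and j would put the difference of two unit vectors into the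
  kernel.\<close>

lemma trivial_kernel_imp_distinct_lin_indpt:
  assumes A: "A \<in> carrier_mat n nc"
    and ker: "\<And>v. v \<in> carrier_vec nc \<Longrightarrow> A *\<^sub>v v = 0\<^sub>v n \<Longrightarrow> v = 0\<^sub>v nc"
  shows "distinct (cols A)" and "lin_indpt (set (cols A))"
proof -
  show d: "distinct (cols A)"
  proof (rule ccontr)
    assume "\<not> distinct (cols A)"
    then obtain i j where ij: "i < nc" "j < nc" "i \<noteq> j" "col A i = col A j"
      using A by (auto simp: distinct_conv_nth)
    let ?v = "unit_vec nc i - unit_vec nc j :: 'a vec"
    have "A *\<^sub>v ?v = col A i - col A j"
    proof -
      have "A *\<^sub>v unit_vec nc l = col A l" if "l < nc" for l
        using A that by (intro eq_vecI) auto
      then show ?thesis using ij by (simp add: mult_minus_distrib_mat_vec[OF A])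
    qed
    also have "\<dots> = 0\<^sub>v n" using ij A by auto
    finally have "?v = 0\<^sub>v nc" by (rule ker[rotated]) simp
    then have "?v $ i = 0" using ij by simp
    then show False using ij by simp
  qed
  show "lin_indpt (set (cols A))"
    using lin_depE[OF A _ d] ker by blast
qed

lemma lin_indpt_imp_trivial_kernel:
  assumes A: "A \<in> carrier_mat n nc" and "distinct (cols A)" and "lin_indpt (set (cols A))"
    and "v \<in> carrier_vec nc" and "A *\<^sub>v v = 0\<^sub>v n"
  shows "v = 0\<^sub>v nc"
  using lin_depI[OF A] assms by blast

text \<open>A maximal independent set of columns has \<open>rank A\<close> elements. Listing it and
  naming a column index for each element turns it into a matrix with trivial kernel, the form in
  which determinants can use it.\<close>

lemma rank_columns:
  assumes A: "A \<in> carrier_mat n nc"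
  obtains c where "rank A \<le> n" and "\<And>j. j < rank A \<Longrightarrow> c j < nc"
    and "\<And>v. v \<in> carrier_vec (rank A) \<Longrightarrow>
           mat n (rank A) (\<lambda>(i, j). A $$ (i, c j)) *\<^sub>v v = 0\<^sub>v n \<Longrightarrow> v = 0\<^sub>v (rank A)"
proof -
  obtain U where maxU: "maximal U (\<lambda>T. T \<subseteq> set (cols A) \<and> lin_indpt T)"
    using maximal_exists_superset[of "set (cols A)" "\<lambda>T. T \<subseteq> set (cols A) \<and> lin_indpt T" "{}"]
    by (auto simp: finite_lin_indpt2)
  have rk: "rank A = card U" using rank_card_indpt[OF A maxU] .
  have U: "U \<subseteq> set (cols A)" "lin_indpt U" using maxU by (auto simp: maximal_def)
  then have le: "rank A \<le> n"
    using li_le_dim(2)[OF fin_dim, of U] dim_is_n cols_dim[of A] A rk by auto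
  have "finite U" using U finite_subset by blast
  then obtain us where us: "set us = U" "distinct us"
    using finite_distinct_list by blast
  then have len: "length us = rank A" using distinct_card rk by fastforce
  have "\<exists>i<nc. us ! j = col A i" if "j < rank A" for j
  proof -
    have "us ! j \<in> set (cols A)" using that len us U by (metis nth_mem subsetD)
    then show ?thesis using A by (auto simp: in_set_conv_nth)
  qed
  then obtain c where c: "\<And>j. j < rank A \<Longrightarrow> c j < nc \<and> us ! j = col A (c j)"
    by metis
  let ?B = "mat n (rank A) (\<lambda>(i, j). A $$ (i, c j))"
  have cols: "cols ?B = us"
    using c len A by (intro nth_equalityI) auto
  have "v = 0\<^sub>v (rank A)" if "v \<in> carrier_vec (rank A)" "?B *\<^sub>v v = 0\<^sub>v n" for v
    using lin_indpt_imp_trivial_kernel[of ?B "rank A" v] that cols us U by simp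
  then show thesis using that c le by blast
qed

end

text \<open>All columns of \<open>A\<close> are orthogonal to \<open>b\<close>, and a nonzero real
  \<open>b\<close> is not orthogonal to itself. Hence bordering k independent columns by
  \<open>b\<close> keeps them independent. The condition on the right is stable under small changes
  of \<open>A\<close> and \<open>b\<close>, which is what it is for.\<close>

lemma rank_eq_iff_bordered_det:
  fixes A :: "real mat"
  assumes A: "A \<in> carrier_mat (Suc k) nc"
    and b: "b \<in> carrier_vec (Suc k)" "b \<noteq> 0\<^sub>v (Suc k)"
    and ker: "transpose_mat A *\<^sub>v b = 0\<^sub>v nc"
  shows "vec_space.rank (Suc k) A = k \<longleftrightarrow>
    (\<exists>c. (\<forall>j<k. c j < nc) \<and>
       det (mat (Suc k) (Suc k) (\<lambda>(i, j). if j < k then A $$ (i, c j) else b $ i)) \<noteq> 0)"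
proof -
  interpret vec_space "TYPE(real)" "Suc k" .
  have orth: "(\<Sum>i<Suc k. A $$ (i, j) * b $ i) = 0" if "j < nc" for j
  proof -
    have "(transpose_mat A *\<^sub>v b) $ j = (\<Sum>i<Suc k. transpose_mat A $$ (j, i) * b $ i)"
      by (rule mult_mat_vec_index_sum) (use A b that in auto)
    also have "\<dots> = (\<Sum>i<Suc k. A $$ (i, j) * b $ i)"
      using A that by (intro sum.cong) auto
    finally show ?thesis using ker that by simp
  qed
  have pos: "(\<Sum>i<Suc k. b $ i * b $ i) > 0"
  proof -
    obtain i where "i < Suc k" "b $ i \<noteq> 0"
      using b by (metis eq_vecI carrier_vecD index_zero_vec)
    then show ?thesis
      by (intro sum_pos2[of _ i]) (auto simp: zero_less_mult_iff)
  qed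
  show ?thesis
  proof
    assume rk: "rank A = k"
    obtain c where c: "\<And>j. j < k \<Longrightarrow> c j < nc"
      and inj: "\<And>v. v \<in> carrier_vec k \<Longrightarrow>
           mat (Suc k) k (\<lambda>(i, j). A $$ (i, c j)) *\<^sub>v v = 0\<^sub>v (Suc k) \<Longrightarrow> v = 0\<^sub>v k"
      by (rule rank_columns[OF A, unfolded rk]) (rule that; assumption)
    let ?M = "mat (Suc k) (Suc k) (\<lambda>(i, j). if j < k then A $$ (i, c j) else b $ i)"
    have "v = 0\<^sub>v (Suc k)" if v: "v \<in> carrier_vec (Suc k)" and Mv: "?M *\<^sub>v v = 0\<^sub>v (Suc k)" for v
    proof -
      have eq: "(\<Sum>j<k. A $$ (i, c j) * v $ j) + b $ i * v $ k = 0" if i: "i < Suc k" for i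
      proof -
        have "0 = (?M *\<^sub>v v) $ i" using Mv i by simp
        also have "\<dots> = (\<Sum>j<Suc k. ?M $$ (i, j) * v $ j)"
          by (rule mult_mat_vec_index_sum) (use v i in auto)
        finally show ?thesis using i by simp
      qed
      \<comment> \<open>Pairing the equations with \<open>b\<close> removes every column of
        \<open>A\<close> by orthogonality and leaves the squared norm of \<open>b\<close> times
        \<open>v $ k\<close>.\<close>
      have "0 = (\<Sum>i<Suc k. b $ i * ((\<Sum>j<k. A $$ (i, c j) * v $ j) + b $ i * v $ k))"
        by (rule sum.neutral[symmetric]) (use eq in auto)
      also have "\<dots> = (\<Sum>i<Suc k. \<Sum>j<k. b $ i * (A $$ (i, c j) * v $ j)) + (\<Sum>i<Suc k. b $ i * b $ i) * v $ k"
        by (simp only: distrib_left sum.distrib sum_distrib_left sum_distrib_right mult.assoc)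
      also have "(\<Sum>i<Suc k. \<Sum>j<k. b $ i * (A $$ (i, c j) * v $ j))
          = (\<Sum>j<k. (\<Sum>i<Suc k. A $$ (i, c j) * b $ i) * v $ j)"
        unfolding sum_distrib_right by (subst sum.swap) (simp only: mult_ac)
      also have "\<dots> = 0" by (rule sum.neutral) (use orth c in auto)
      finally have vk: "v $ k = 0" using pos by simp
      let ?w = "vec k (\<lambda>j. v $ j)"
      have "mat (Suc k) k (\<lambda>(i, j). A $$ (i, c j)) *\<^sub>v ?w = 0\<^sub>v (Suc k)"
      proof (rule eq_vecI)
        fix i assume "i < dim_vec (0\<^sub>v (Suc k) :: real vec)"
        then have i: "i < Suc k" by simp
        have "(mat (Suc k) k (\<lambda>(i, j). A $$ (i, c j)) *\<^sub>v ?w) $ i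
            = (\<Sum>j<k. mat (Suc k) k (\<lambda>(i, j). A $$ (i, c j)) $$ (i, j) * ?w $ j)"
          by (rule mult_mat_vec_index_sum) (use i in auto)
        also have "\<dots> = (\<Sum>j<k. A $$ (i, c j) * v $ j)"
          using i by (intro sum.cong) auto
        also have "\<dots> = 0" using eq[OF i] vk by simp
        finally show "(mat (Suc k) k (\<lambda>(i, j). A $$ (i, c j)) *\<^sub>v ?w) $ i = 0\<^sub>v (Suc k) $ i"
          using i by simp
      qed simp
      then have w: "?w = 0\<^sub>v k" by (rule inj[rotated]) auto
      have "v $ j = 0" if "j < k" for j
        using arg_cong[OF w, of "\<lambda>u. u $ j"] that by simp
      then show ?thesis using v vk by (intro eq_vecI) (auto simp: less_Suc_eq)
    qed
    then have "det ?M \<noteq> 0"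
      using det_0_iff_vec_prod_zero_field[of ?M "Suc k"] by auto
    then show "\<exists>c. (\<forall>j<k. c j < nc) \<and>
       det (mat (Suc k) (Suc k) (\<lambda>(i, j). if j < k then A $$ (i, c j) else b $ i)) \<noteq> 0"
      using c by blast
  next
    assume "\<exists>c. (\<forall>j<k. c j < nc) \<and>
       det (mat (Suc k) (Suc k) (\<lambda>(i, j). if j < k then A $$ (i, c j) else b $ i)) \<noteq> 0"
    then obtain c where c: "\<And>j. j < k \<Longrightarrow> c j < nc"
      and det: "det (mat (Suc k) (Suc k) (\<lambda>(i, j). if j < k then A $$ (i, c j) else b $ i)) \<noteq> 0"
        (is "det ?M \<noteq> 0")
      by blast
    let ?B = "mat (Suc k) k (\<lambda>(i, j). A $$ (i, c j))"
    have inj: "v = 0\<^sub>v k" if v: "v \<in> carrier_vec k" and Bv: "?B *\<^sub>v v = 0\<^sub>v (Suc k)" for v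
    proof -
      \<comment> \<open>A kernel vector of the k columns becomes one of the bordered matrix when the
        border gets coefficient 0.\<close>
      let ?w = "vec (Suc k) (\<lambda>j. if j < k then v $ j else 0)"
      have "?M *\<^sub>v ?w = 0\<^sub>v (Suc k)"
      proof (rule eq_vecI)
        fix i assume "i < dim_vec (0\<^sub>v (Suc k) :: real vec)"
        then have i: "i < Suc k" by simp
        have "(?M *\<^sub>v ?w) $ i = (\<Sum>j<Suc k. ?M $$ (i, j) * ?w $ j)"
          by (rule mult_mat_vec_index_sum) (use i in auto)
        also have "\<dots> = (\<Sum>j<k. ?B $$ (i, j) * v $ j)"
          using i by simp
        also have "\<dots> = (?B *\<^sub>v v) $ i"
          by (rule mult_mat_vec_index_sum[symmetric]) (use i v in auto)
        finally show "(?M *\<^sub>v ?w) $ i = 0\<^sub>v (Suc k) $ i" using Bv by simp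
      qed simp
      then have w: "?w = 0\<^sub>v (Suc k)"
        by (rule det_nonzero_imp_zero[of ?M, OF _ det, rotated 2]) auto
      have "v $ j = 0" if "j < k" for j
        using arg_cong[OF w, of "\<lambda>u. u $ j"] that by simp
      then show ?thesis using v by (intro eq_vecI) auto
    qed
    have B: "?B \<in> carrier_mat (Suc k) k" by simp
    note li = trivial_kernel_imp_distinct_lin_indpt[OF B inj]
    have sub: "set (cols ?B) \<subseteq> set (cols A)"
    proof
      fix u assume "u \<in> set (cols ?B)"
      then obtain j where j: "j < k" "u = col ?B j" by (auto simp: in_set_conv_nth)
      then have "u = col A (c j)" using A c by (intro eq_vecI) auto
      then show "u \<in> set (cols A)" using c[OF j(1)] A by (auto simp: cols_def)
    qed
    have "card (set (cols ?B)) = k" using li(1) by (simp add: distinct_card)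
    then have ge: "k \<le> rank A" using rank_ge_card_indpt[OF A sub li(2)] by simp
    \<comment> \<open>Full rank would give Suc k columns forming an invertible matrix whose
      transpose annihilates the nonzero \<open>b\<close>.\<close>
    have "rank A \<noteq> Suc k"
    proof
      assume rk: "rank A = Suc k"
      obtain d where d: "\<And>j. j < Suc k \<Longrightarrow> d j < nc"
        and inj: "\<And>v. v \<in> carrier_vec (Suc k) \<Longrightarrow>
             mat (Suc k) (Suc k) (\<lambda>(i, j). A $$ (i, d j)) *\<^sub>v v = 0\<^sub>v (Suc k) \<Longrightarrow> v = 0\<^sub>v (Suc k)"
        by (rule rank_columns[OF A, unfolded rk]) (rule that; assumption)
      let ?D = "mat (Suc k) (Suc k) (\<lambda>(i, j). A $$ (i, d j))"
      have D: "?D \<in> carrier_mat (Suc k) (Suc k)" by simp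
      have "det ?D \<noteq> 0"
        using det_0_iff_vec_prod_zero_field[OF D] inj by blast
      then have dT: "det (transpose_mat ?D) \<noteq> 0" using det_transpose[OF D] by simp
      have "transpose_mat ?D *\<^sub>v b = 0\<^sub>v (Suc k)"
      proof (rule eq_vecI)
        fix i assume "i < dim_vec (0\<^sub>v (Suc k) :: real vec)"
        then have i: "i < Suc k" by simp
        have "(transpose_mat ?D *\<^sub>v b) $ i = (\<Sum>j<Suc k. transpose_mat ?D $$ (i, j) * b $ j)"
          by (rule mult_mat_vec_index_sum) (use i b in auto)
        also have "\<dots> = (\<Sum>j<Suc k. A $$ (j, d i) * b $ j)"
          by (rule sum.cong) (use i in auto)
        also have "\<dots> = 0" using orth d[OF i] by simp
        finally show "(transpose_mat ?D *\<^sub>v b) $ i = 0\<^sub>v (Suc k) $ i" using i by simp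
      qed simp
      then have "b = 0\<^sub>v (Suc k)"
        by (rule det_nonzero_imp_zero[of "transpose_mat ?D", OF _ dT b(1), rotated 1]) auto
      then show False using b by simp
    qed
    moreover have "rank A \<le> Suc k" using rank_columns[OF A] by blast
    ultimately show "rank A = k" using ge by simp
  qed
qed

section \<open>Subvectors, recurrences and rank in coordinates\<close>

lemma pick_interval_diff:
  assumes "u + w \<le> n" and "k < n - w"
  shows "pick ({0..<n} - {u..<u + w}) k = (if k < u then k else k + w)"
proof -
  let ?I = "{0..<n} - {u..<u + w}"
  let ?i = "if k < u then k else k + w"
  have "?i \<in> ?I" using assms by auto
  \<comment> \<open>The k-th element of a set, counted from 0, is the one with exactly k elements of
    the set below it.\<close>
  moreover have "card {j \<in> ?I. j < ?i} = k"
  proof (cases "k < u")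
    case True
    then have "{j \<in> ?I. j < ?i} = {0..<k}" using assms by auto
    then show ?thesis by simp
  next
    case False
    then have "{j \<in> ?I. j < ?i} = {0..<u} \<union> {u + w..<k + w}" using assms by auto
    then show ?thesis using False by (simp add: card_Un_disjoint)
  qed
  ultimately show ?thesis using pick_card_in_set[of ?i ?I] by simp
qed

lemma card_interval_diff:
  fixes u w n :: nat
  assumes "u + w \<le> n"
  shows "card ({0..<n} - {u..<u + w}) = n - w"
  using assms by (subst card_Diff_subset) auto

lemma subvec_index_I:
  assumes "\<tau> \<le> r" and "r \<le> N"
  shows "subvec T (index_I N r \<tau>) = vec r (\<lambda>k. T $ (if k < \<tau> then k else k + (N - r)))"
proof -
  have I: "index_I N r \<tau> = {0..<N} - {\<tau>..<\<tau> + (N - r)}"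
    by (simp add: index_I_def add.commute)
  have "card (index_I N r \<tau>) = r"
    unfolding I using assms by (subst card_interval_diff) auto
  moreover have "pick (index_I N r \<tau>) k = (if k < \<tau> then k else k + (N - r))" if "k < r" for k
    unfolding I by (rule pick_interval_diff) (use assms that in auto)
  ultimately show ?thesis
    unfolding subvec_def by (intro eq_vecI) auto
qed

lemma subvec_index_K:
  assumes "\<tau> \<le> r"
  shows "subvec a (index_K r \<tau>) = vec r (\<lambda>k. a $ (if k < \<tau> then k else k + 1))"
proof -
  have K: "index_K r \<tau> = {0..<r + 1} - {\<tau>..<\<tau> + 1}"
    by (auto simp: index_K_def)
  have "card (index_K r \<tau>) = r"
    unfolding K using assms by (subst card_interval_diff) auto
  moreover have "pick (index_K r \<tau>) k = (if k < \<tau> then k else k + 1)" if "k < r" for k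
    unfolding K by (rule pick_interval_diff) (use assms that in auto)
  ultimately show ?thesis
    unfolding subvec_def by (intro eq_vecI) auto
qed

lemma governed_iff:
  assumes "b \<in> carrier_vec (Suc m)" and "S \<in> carrier_vec N" and "m < N"
  shows "governed b S \<longleftrightarrow> (\<forall>k<N - m. (\<Sum>i\<le>m. b $ i * S $ (k + i)) = 0)"
proof -
  let ?H = "hankel (dim_vec b) S"
  have H: "transpose_mat ?H \<in> carrier_mat (N - m) (Suc m)"
    using assms by (auto simp: hankel_def)
  have dims: "dim_vec S - dim_vec b + 1 = N - m" using assms by auto
  have "(transpose_mat ?H *\<^sub>v b) $ k = (\<Sum>i\<le>m. b $ i * S $ (k + i))" if "k < N - m" for k
  proof -
    have "(transpose_mat ?H *\<^sub>v b) $ k = (\<Sum>i<Suc m. transpose_mat ?H $$ (k, i) * b $ i)"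
      by (rule mult_mat_vec_index_sum[OF H assms(1) that])
    also have "\<dots> = (\<Sum>i\<le>m. b $ i * S $ (k + i))"
      using that assms by (intro sum.cong) (auto simp: hankel_def add.commute)
    finally show ?thesis .
  qed
  moreover have "dim_vec (transpose_mat ?H *\<^sub>v b) = N - m" using H by auto
  ultimately show ?thesis
    unfolding governed_def dims by (auto simp: vec_eq_iff)
qed

text \<open>The bordered determinant for a Hankel matrix, written in the entries of \<open>S\<close>
  and \<open>b\<close> themselves, so that its continuous dependence on the series and the
  recurrence can be read off.\<close>

lemma rank_series_iff_bordered_det:
  assumes b: "b \<in> carrier_vec (Suc r)" "b \<noteq> 0\<^sub>v (Suc r)" and S: "S \<in> carrier_vec N"
    and "r < N" and gov: "governed b S"
  shows "S \<in> rank_series N r \<longleftrightarrow>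
    (\<exists>c. (\<forall>j<r. c j < N - r) \<and>
       det (mat (Suc r) (Suc r) (\<lambda>(i, j). if j < r then S $ (i + c j) else b $ i)) \<noteq> 0)"
proof -
  have nc: "N - r = dim_vec S - dim_vec b + 1" using assms by auto
  have H: "hankel (Suc r) S \<in> carrier_mat (Suc r) (N - r)"
    using assms by (auto simp: hankel_def)
  have ker: "transpose_mat (hankel (Suc r) S) *\<^sub>v b = 0\<^sub>v (N - r)"
    using gov b unfolding governed_def nc by simp
  have eq: "mat (Suc r) (Suc r) (\<lambda>(i, j). if j < r then hankel (Suc r) S $$ (i, c j) else b $ i)
      = mat (Suc r) (Suc r) (\<lambda>(i, j). if j < r then S $ (i + c j) else b $ i)"
    if "\<forall>j<r. c j < N - r" for c
    using that assms by (intro eq_matI) (auto simp: hankel_def)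
  have "S \<in> rank_series N r \<longleftrightarrow> vec_space.rank (Suc r) (hankel (Suc r) S) = r"
    using S by (simp add: rank_series_def)
  also have "\<dots> \<longleftrightarrow> (\<exists>c. (\<forall>j<r. c j < N - r) \<and>
      det (mat (Suc r) (Suc r) (\<lambda>(i, j). if j < r then hankel (Suc r) S $$ (i, c j) else b $ i)) \<noteq> 0)"
    by (rule rank_eq_iff_bordered_det[OF H b ker])
  also have "\<dots> \<longleftrightarrow> (\<exists>c. (\<forall>j<r. c j < N - r) \<and>
      det (mat (Suc r) (Suc r) (\<lambda>(i, j). if j < r then S $ (i + c j) else b $ i)) \<noteq> 0)"
    by (intro ex_cong1 conj_cong refl) (simp only: eq)
  finally show ?thesis .
qed

text \<open>Since \<open>p\<close> is the last index with a nonzero coefficient, the k-th recurrence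
  expresses \<open>z (k + p)\<close> by earlier entries. Only the first \<open>p\<close> and the
  last \<open>m - p\<close> entries are not reached in this way. Serves both the recurrence of a
  parameter point and the self-convolution.\<close>

lemma glrr_vanishes:
  fixes b z :: "nat \<Rightarrow> real"
  assumes p: "p \<le> m" "b p \<noteq> 0" "\<And>i. p < i \<Longrightarrow> i \<le> m \<Longrightarrow> b i = 0"
    and gov: "\<And>k. k < N - m \<Longrightarrow> (\<Sum>i\<le>m. b i * z (k + i)) = 0"
    and out: "\<And>i. i < p \<Longrightarrow> z i = 0" "\<And>i. N - m + p \<le> i \<Longrightarrow> i < N \<Longrightarrow> z i = 0"
  shows "i < N \<Longrightarrow> z i = 0"
proof (induction i rule: less_induct)
  case (less i)
  consider "i < p" | "N - m + p \<le> i" | k where "i = k + p" "k < N - m"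
    by (metis add.commute le_add_diff_inverse less_diff_conv2 linorder_not_le)
  then show ?case
  proof cases
    case 3
    \<comment> \<open>Terms above \<open>p\<close> have coefficient 0 and terms below
      \<open>p\<close> vanish by induction, so only \<open>b p * z i\<close> is left.\<close>
    have "(\<Sum>j\<le>m. b j * z (k + j)) = (\<Sum>j\<in>{p}. b j * z (k + j))"
      using p less 3 by (intro sum.mono_neutral_right) (auto simp: nat_neq_iff)
    then show ?thesis using gov[OF 3(2)] p 3 by simp
  qed (use out less in auto)
qed

text \<open>Rank r makes the left kernel of the Hankel matrix a line. Concretely, the part of
  \<open>b\<close> orthogonal to \<open>a\<close> is also orthogonal to r independent columns, so
  the transposed bordered matrix, which is invertible, sends it to zero.\<close>

lemma governed_unique_up_to_scaling:
  assumes S: "S \<in> rank_series N r" and "r < N"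
    and a: "a \<in> carrier_vec (Suc r)" "a \<noteq> 0\<^sub>v (Suc r)" "governed a S"
    and b: "b \<in> carrier_vec (Suc r)" "governed b S"
  obtains c where "b = c \<cdot>\<^sub>v a"
proof -
  have Sc: "S \<in> carrier_vec N" using S by (auto simp: rank_series_def)
  obtain i where i: "i \<le> r" "a $ i \<noteq> 0"
    using a by (metis eq_vecI carrier_vecD index_zero_vec less_Suc_eq_le)
  have ga: "\<And>k. k < N - r \<Longrightarrow> (\<Sum>i\<le>r. a $ i * S $ (k + i)) = 0"
    using a governed_iff[OF a(1) Sc \<open>r < N\<close>] by auto
  have gb: "\<And>k. k < N - r \<Longrightarrow> (\<Sum>i\<le>r. b $ i * S $ (k + i)) = 0"
    using b governed_iff[OF b(1) Sc \<open>r < N\<close>] by auto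
  obtain s where s: "\<forall>j<r. s j < N - r"
    and det: "det (mat (Suc r) (Suc r) (\<lambda>(i, j). if j < r then S $ (i + s j) else a $ i)) \<noteq> 0"
      (is "det ?M \<noteq> 0")
    using S rank_series_iff_bordered_det[OF a(1,2) Sc \<open>r < N\<close> a(3)] by blast
  \<comment> \<open>The coefficient of the orthogonal projection of \<open>b\<close> onto
    \<open>a\<close>.\<close>
  define e where "e = (\<Sum>i\<le>r. a $ i * b $ i) / (\<Sum>i\<le>r. a $ i * a $ i)"
  have M: "transpose_mat ?M \<in> carrier_mat (Suc r) (Suc r)" by simp
  have pos: "(\<Sum>i\<le>r. a $ i * a $ i) > 0"
    using i by (intro sum_pos2[of _ i]) (auto simp: zero_less_mult_iff)
  have "transpose_mat ?M *\<^sub>v (b - e \<cdot>\<^sub>v a) = 0\<^sub>v (Suc r)"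
  proof (rule eq_vecI)
    fix k assume "k < dim_vec (0\<^sub>v (Suc r) :: real vec)"
    then have k: "k < Suc r" by simp
    have "(transpose_mat ?M *\<^sub>v (b - e \<cdot>\<^sub>v a)) $ k
        = (\<Sum>j<Suc r. transpose_mat ?M $$ (k, j) * (b - e \<cdot>\<^sub>v a) $ j)"
      by (rule mult_mat_vec_index_sum[OF M _ k]) (use a b in auto)
    also have "\<dots> = (\<Sum>j\<le>r. (if k < r then S $ (s k + j) else a $ j) * (b $ j - e * a $ j))"
      using k a b by (intro sum.cong) (auto simp: add.commute)
    also have "\<dots> = 0"
    proof (cases "k < r")
      case True
      have "(\<Sum>j\<le>r. S $ (s k + j) * (b $ j - e * a $ j))
          = (\<Sum>j\<le>r. b $ j * S $ (s k + j)) - e * (\<Sum>j\<le>r. a $ j * S $ (s k + j))"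
        by (simp add: algebra_simps sum_subtractf sum_distrib_left)
      then show ?thesis using True ga gb s by simp
    next
      case False
      have "(\<Sum>j\<le>r. a $ j * (b $ j - e * a $ j))
          = (\<Sum>j\<le>r. a $ j * b $ j) - e * (\<Sum>j\<le>r. a $ j * a $ j)"
        by (simp add: algebra_simps sum_subtractf sum_distrib_left)
      then show ?thesis using False pos by (simp add: e_def)
    qed
    finally show "(transpose_mat ?M *\<^sub>v (b - e \<cdot>\<^sub>v a)) $ k = 0\<^sub>v (Suc r) $ k" using k by simp
  qed simp
  moreover have "det (transpose_mat ?M) \<noteq> 0"
    using det by (subst det_transpose[of _ "Suc r"]) auto
  ultimately have "b - e \<cdot>\<^sub>v a = 0\<^sub>v (Suc r)"
    using det_nonzero_imp_zero[OF M, of "b - e \<cdot>\<^sub>v a"] a b by auto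
  then have d: "(b - e \<cdot>\<^sub>v a) $ k = 0" if "k < Suc r" for k
    using that by simp
  have "b = e \<cdot>\<^sub>v a"
    by (rule eq_vecI) (use a b d in auto)
  then show thesis using that by blast
qed

section \<open>Self-convolution as a twice applied recurrence\<close>

text \<open>Both sides add the products of \<open>a $ j\<close>, \<open>a $ l\<close> and
  \<open>z (k + j + l)\<close> over all j, l up to r; the left side groups them by i = j +
  l.\<close>

lemma self_convolution_sum:
  fixes a :: "real vec"
  shows "(\<Sum>i\<le>2 * r. self_convolution r a $ i * z (k + i))
    = (\<Sum>j\<le>r. a $ j * (\<Sum>l\<le>r. a $ l * z (k + j + l)))"
proof -
  have "(\<Sum>i\<le>2 * r. self_convolution r a $ i * z (k + i))
      = (\<Sum>i\<le>2 * r. \<Sum>j\<in>{j. j \<le> r \<and> j \<le> i \<and> i - j \<le> r}. a $ j * (a $ (i - j) * z (k + i)))"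
  proof (intro sum.cong refl)
    fix i assume "i \<in> {..2 * r}"
    moreover have "{i - r..min i r} = {j. j \<le> r \<and> j \<le> i \<and> i - j \<le> r}" by auto
    ultimately show "self_convolution r a $ i * z (k + i)
        = (\<Sum>j\<in>{j. j \<le> r \<and> j \<le> i \<and> i - j \<le> r}. a $ j * (a $ (i - j) * z (k + i)))"
      by (simp add: self_convolution_def sum_distrib_right mult.assoc)
  qed
  also have "\<dots> = (\<Sum>j\<le>r. \<Sum>l\<le>r. a $ j * (a $ l * z (k + j + l)))"
    unfolding sum.Sigma[OF finite_atMost ballI[OF finite_atMost]]
    by (subst sum.Sigma; (simp; fail)?)
      (rule sum.reindex_bij_witness[where i = "\<lambda>(j, l). (j + l, j)" and j = "\<lambda>(i, j). (j, i - j)"], auto)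
  finally show ?thesis by (simp add: sum_distrib_left)
qed

text \<open>If two indices add up to more than \<open>2 * \<tau>\<close>, one of them exceeds
  \<open>\<tau>\<close>; if they add up to \<open>2 * \<tau>\<close>, both are \<open>\<tau>\<close>
  or one exceeds it. This supplies the leading coefficient needed by
  \<open>glrr_vanishes\<close>.\<close>

lemma self_convolution_top:
  fixes a :: "real vec"
  assumes "\<tau> \<le> r" and "\<And>i. \<tau> < i \<Longrightarrow> i \<le> r \<Longrightarrow> a $ i = 0"
  shows "self_convolution r a $ (2 * \<tau>) = a $ \<tau> * a $ \<tau>"
    and "2 * \<tau> < i \<Longrightarrow> i \<le> 2 * r \<Longrightarrow> self_convolution r a $ i = 0"
proof -
  have "(\<Sum>j = 2 * \<tau> - r..min (2 * \<tau>) r. a $ j * a $ (2 * \<tau> - j)) = (\<Sum>j\<in>{\<tau>}. a $ j * a $ (2 * \<tau> - j))"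
    using assms by (intro sum.mono_neutral_right) (auto simp: nat_neq_iff)
  then show "self_convolution r a $ (2 * \<tau>) = a $ \<tau> * a $ \<tau>"
    using assms by (simp add: self_convolution_def)
  assume i: "2 * \<tau> < i" "i \<le> 2 * r"
  have "(\<Sum>j = i - r..min i r. a $ j * a $ (i - j)) = 0"
  proof (intro sum.neutral ballI)
    fix j assume "j \<in> {i - r..min i r}"
    then show "a $ j * a $ (i - j) = 0"
      using i assms(2)[of j] assms(2)[of "i - j"] by (cases "\<tau> < j") auto
  qed
  then show "self_convolution r a $ i = 0"
    using i by (simp add: self_convolution_def)
qed

section \<open>The linear system of a parameter point and its Cramer solution\<close>

text \<open>The recurrence with -1 inserted at \<open>\<tau>\<close>, read directly off the second
  half of \<open>y\<close>, which starts at index r. Each coefficient is thus a constant or a single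
  coordinate of \<open>y\<close>, which makes limits and derivatives immediate.\<close>

definition glrr_coeff :: "nat \<Rightarrow> nat \<Rightarrow> real vec \<Rightarrow> nat \<Rightarrow> real" where
  "glrr_coeff r \<tau> y i = (if i < \<tau> then y $ (r + i) else if i = \<tau> then -1 else y $ (r + (i - 1)))"

text \<open>
  The square system for the series with parameter point \<open>y\<close>: row \<open>k < N - r\<close> is the \<open>k\<close>-th
  recurrence, row \<open>N - r + k\<close> prescribes the entry at the \<open>k\<close>-th index of \<open>index_I N r \<tau>\<close>.
\<close>

definition glrr_matrix :: "nat \<Rightarrow> nat \<Rightarrow> nat \<Rightarrow> real vec \<Rightarrow> real mat" where
  "glrr_matrix N r \<tau> y = mat N N (\<lambda>(k, j).
     if k < N - r then (if k \<le> j \<and> j \<le> k + r then glrr_coeff r \<tau> y (j - k) else 0)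
     else if j = (if k - (N - r) < \<tau> then k - (N - r) else k) then 1 else 0)"

definition glrr_rhs :: "nat \<Rightarrow> nat \<Rightarrow> real vec \<Rightarrow> real vec" where
  "glrr_rhs N r y = vec N (\<lambda>k. if k < N - r then 0 else y $ (k - (N - r)))"

text \<open>Cramer's quotients serve as the definition, so that regularity in \<open>y\<close>
  reduces to that of determinants. They are known to solve the system where the denominator is
  nonzero.\<close>

definition glrr_solution :: "nat \<Rightarrow> nat \<Rightarrow> nat \<Rightarrow> real vec \<Rightarrow> real vec" where
  "glrr_solution N r \<tau> y = vec N (\<lambda>k.
     det (replace_col (glrr_matrix N r \<tau> y) (glrr_rhs N r y) k) / det (glrr_matrix N r \<tau> y))"

lemma glrr_matrix_carrier [simp]: "glrr_matrix N r \<tau> y \<in> carrier_mat N N"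
  and glrr_rhs_carrier [simp]: "glrr_rhs N r y \<in> carrier_vec N"
  and glrr_solution_carrier [simp]: "glrr_solution N r \<tau> y \<in> carrier_vec N"
  by (simp_all add: glrr_matrix_def glrr_rhs_def glrr_solution_def)

lemma insert_minus1_vec_last:
  assumes "y \<in> carrier_vec (2 * r)" and "\<tau> \<le> r"
  shows "insert_minus1 r \<tau> (vec_last y r) = vec (Suc r) (glrr_coeff r \<tau> y)"
  using assms by (intro eq_vecI) (auto simp: insert_minus1_def vec_last_def glrr_coeff_def)

lemma glrr_matrix_mult_upper:
  assumes "T \<in> carrier_vec N" and "r < N" and "k < N - r"
  shows "(glrr_matrix N r \<tau> y *\<^sub>v T) $ k = (\<Sum>i\<le>r. glrr_coeff r \<tau> y i * T $ (k + i))"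
proof -
  have "(glrr_matrix N r \<tau> y *\<^sub>v T) $ k = (\<Sum>j<N. glrr_matrix N r \<tau> y $$ (k, j) * T $ j)"
    by (rule mult_mat_vec_index_sum[OF glrr_matrix_carrier assms(1)]) (use assms in auto)
  also have "\<dots> = (\<Sum>j\<in>{k..k + r}. glrr_coeff r \<tau> y (j - k) * T $ j)"
    using assms by (intro sum.mono_neutral_cong_right) (auto simp: glrr_matrix_def)
  also have "\<dots> = (\<Sum>i\<le>r. glrr_coeff r \<tau> y i * T $ (k + i))"
    by (rule sum.reindex_bij_witness[where i = "\<lambda>i. k + i" and j = "\<lambda>j. j - k"]) auto
  finally show ?thesis .
qed

lemma glrr_matrix_mult_lower:
  assumes "T \<in> carrier_vec N" and "r < N" and "k < r"
  shows "(glrr_matrix N r \<tau> y *\<^sub>v T) $ (k + (N - r)) = T $ (if k < \<tau> then k else k + (N - r))"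
proof -
  let ?p = "if k < \<tau> then k else k + (N - r)"
  have "(glrr_matrix N r \<tau> y *\<^sub>v T) $ (k + (N - r))
      = (\<Sum>j<N. glrr_matrix N r \<tau> y $$ (k + (N - r), j) * T $ j)"
    by (rule mult_mat_vec_index_sum[OF glrr_matrix_carrier assms(1)]) (use assms in auto)
  also have "\<dots> = (\<Sum>j<N. if j = ?p then T $ j else 0)"
    using assms by (intro sum.cong refl) (auto simp: glrr_matrix_def)
  also have "\<dots> = T $ ?p" using assms by auto
  finally show ?thesis .
qed

lemma governed_insert_minus1_iff:
  assumes "y \<in> carrier_vec (2 * r)" and "\<tau> \<le> r" and "r < N" and "T \<in> carrier_vec N"
  shows "governed (insert_minus1 r \<tau> (vec_last y r)) T \<longleftrightarrow>
    (\<forall>k<N - r. (\<Sum>i\<le>r. glrr_coeff r \<tau> y i * T $ (k + i)) = 0)"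
  using assms by (simp add: insert_minus1_vec_last governed_iff[of _ r T N])

text \<open>Apart from the rank, all conditions on \<open>T\<close> are linear and make up exactly
  the N rows of the system. This replaces the description by \<open>THE\<close> with linear
  algebra.\<close>

lemma param_series_iff:
  assumes y: "y \<in> carrier_vec (2 * r)" and "\<tau> \<le> r" and "r < N"
  shows "param_series N r \<tau> y T \<longleftrightarrow>
    T \<in> rank_series N r \<and> glrr_matrix N r \<tau> y *\<^sub>v T = glrr_rhs N r y"
proof (cases "T \<in> rank_series N r")
  case True
  then have T: "T \<in> carrier_vec N" by (simp add: rank_series_def)
  have sub: "subvec T (index_I N r \<tau>) = vec_first y r \<longleftrightarrow>
      (\<forall>k<r. T $ (if k < \<tau> then k else k + (N - r)) = y $ k)"
    using assms by (simp add: subvec_index_I vec_first_def vec_eq_iff)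
  have "glrr_matrix N r \<tau> y *\<^sub>v T = glrr_rhs N r y \<longleftrightarrow>
      (\<forall>k<N. (glrr_matrix N r \<tau> y *\<^sub>v T) $ k = (if k < N - r then 0 else y $ (k - (N - r))))"
    by (auto simp: vec_eq_iff glrr_rhs_def glrr_matrix_def)
  also have "\<dots> \<longleftrightarrow> (\<forall>k<N - r. (glrr_matrix N r \<tau> y *\<^sub>v T) $ k = 0) \<and>
      (\<forall>k<r. (glrr_matrix N r \<tau> y *\<^sub>v T) $ (k + (N - r)) = y $ k)" (is "?l \<longleftrightarrow> ?r")
  proof
    assume l: ?l
    show ?r
    proof (intro conjI allI impI)
      fix k assume "k < r"
      then show "(glrr_matrix N r \<tau> y *\<^sub>v T) $ (k + (N - r)) = y $ k"
        using l[rule_format, of "k + (N - r)"] \<open>r < N\<close> by simp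
    qed (use l \<open>r < N\<close> in auto)
  next
    assume r: ?r
    show ?l
    proof (intro allI impI)
      fix k assume "k < N"
      then show "(glrr_matrix N r \<tau> y *\<^sub>v T) $ k = (if k < N - r then 0 else y $ (k - (N - r)))"
      proof (cases "k < N - r")
        case False
        then have "k - (N - r) < r" "k - (N - r) + (N - r) = k" using \<open>k < N\<close> \<open>r < N\<close> by auto
        then show ?thesis using r False by metis
      qed (use r in simp)
    qed
  qed
  also have "\<dots> \<longleftrightarrow> (\<forall>k<N - r. (\<Sum>i\<le>r. glrr_coeff r \<tau> y i * T $ (k + i)) = 0) \<and>
      (\<forall>k<r. T $ (if k < \<tau> then k else k + (N - r)) = y $ k)"
    by (intro arg_cong2[where f = "(\<and>)"] iff_allI imp_cong refl)
      (simp_all only: glrr_matrix_mult_upper[OF T \<open>r < N\<close>] glrr_matrix_mult_lower[OF T \<open>r < N\<close>])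
  finally show ?thesis
    unfolding param_series_def sub governed_insert_minus1_iff[OF assms T] using True by blast
qed (simp add: param_series_def)

lemma cramer_solution:
  fixes A :: "'a :: field mat"
  assumes "A \<in> carrier_mat n n" and "det A \<noteq> 0" and "v \<in> carrier_vec n"
  shows "vec n (\<lambda>k. det (replace_col A (A *\<^sub>v v) k) / det A) = v"
  using assms by (intro eq_vecI) (auto simp: cramer_lemma_mat)

lemma glrr_matrix_solution:
  assumes "det (glrr_matrix N r \<tau> y) \<noteq> 0"
  shows "glrr_matrix N r \<tau> y *\<^sub>v glrr_solution N r \<tau> y = glrr_rhs N r y"
proof -
  \<comment> \<open>Cramer's rule is available for a right-hand side of the form
    \<open>A *\<^sub>v v\<close>, so some solution is taken first.\<close>
  obtain v where "v \<in> carrier_vec N" "glrr_matrix N r \<tau> y *\<^sub>v v = glrr_rhs N r y"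
    using det_nonzero_imp_solution[OF glrr_matrix_carrier assms glrr_rhs_carrier] by blast
  then show ?thesis
    using cramer_solution[OF glrr_matrix_carrier assms, of v] by (simp add: glrr_solution_def)
qed

lemma glrr_solution_unique:
  assumes "det (glrr_matrix N r \<tau> y) \<noteq> 0" and "T \<in> carrier_vec N"
    and "glrr_matrix N r \<tau> y *\<^sub>v T = glrr_rhs N r y"
  shows "T = glrr_solution N r \<tau> y"
  using cramer_solution[OF glrr_matrix_carrier assms(1,2)] assms(3) by (simp add: glrr_solution_def)

text \<open>A kernel vector obeys the recurrence and is zero at the first \<open>\<tau>\<close> and
  the last \<open>r - \<tau>\<close> indices. With no coefficient beyond \<open>\<tau>\<close>, the
  recurrence makes all other entries zero from left to right.\<close>

lemma det_glrr_matrix_nonzero: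
  assumes "\<tau> \<le> r" and "r < N" and "\<And>i. \<tau> < i \<Longrightarrow> i \<le> r \<Longrightarrow> glrr_coeff r \<tau> y i = 0"
  shows "det (glrr_matrix N r \<tau> y) \<noteq> 0"
proof
  assume "det (glrr_matrix N r \<tau> y) = 0"
  then obtain v where v: "v \<in> carrier_vec N" "v \<noteq> 0\<^sub>v N" "glrr_matrix N r \<tau> y *\<^sub>v v = 0\<^sub>v N"
    using det_0_iff_vec_prod_zero_field[OF glrr_matrix_carrier] by blast
  have "v $ i = 0" if "i < N" for i
  proof (rule glrr_vanishes[of \<tau> r "glrr_coeff r \<tau> y" N "\<lambda>i. v $ i"])
    fix k assume "k < N - r"
    then show "(\<Sum>i\<le>r. glrr_coeff r \<tau> y i * v $ (k + i)) = 0"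
      using glrr_matrix_mult_upper[OF v(1) \<open>r < N\<close>, of k \<tau> y] v(3) by simp
  next
    fix k assume "k < \<tau>"
    then show "v $ k = 0"
      using glrr_matrix_mult_lower[OF v(1) \<open>r < N\<close>, of k \<tau> y] v(3) assms by simp
  next
    fix k assume "N - r + \<tau> \<le> k" "k < N"
    then have "k - (N - r) < r" "k - (N - r) + (N - r) = k" "\<not> k - (N - r) < \<tau>"
      using assms by auto
    with \<open>k < N\<close> show "v $ k = 0"
      using glrr_matrix_mult_lower[OF v(1) \<open>r < N\<close>, of "k - (N - r)" \<tau> y] v(3) assms by simp
  qed (use assms that in \<open>auto simp: glrr_coeff_def\<close>)
  then have "v = 0\<^sub>v N" using v(1) by (intro eq_vecI) auto
  then show False using v(2) by simp
qed

section \<open>Limits and derivatives in coordinates\<close>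

text \<open>The boxes of \<open>S_map_defined_near\<close> as a filter, so that conditions valid
  near \<open>x\<close> combine without explicit radii.\<close>

definition coord_nhds :: "nat \<Rightarrow> real vec \<Rightarrow> real vec filter" where
  "coord_nhds n x =
     (INF \<epsilon>\<in>{0<..}. principal {y \<in> carrier_vec n. \<forall>k<n. \<bar>y $ k - x $ k\<bar> < \<epsilon>})"

lemma eventually_coord_nhds:
  "eventually P (coord_nhds n x) \<longleftrightarrow>
    (\<exists>\<epsilon>>0. \<forall>y\<in>carrier_vec n. (\<forall>k<n. \<bar>y $ k - x $ k\<bar> < \<epsilon>) \<longrightarrow> P y)"
proof -
  have "eventually P (coord_nhds n x) \<longleftrightarrow>
    (\<exists>\<epsilon>\<in>{0<..}. eventually P (principal {y \<in> carrier_vec n. \<forall>k<n. \<bar>y $ k - x $ k\<bar> < \<epsilon>}))"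
    unfolding coord_nhds_def
  proof (rule eventually_INF_base)
    fix a b :: real assume "a \<in> {0<..}" "b \<in> {0<..}"
    then show "\<exists>e\<in>{0<..}. principal {y \<in> carrier_vec n. \<forall>k<n. \<bar>y $ k - x $ k\<bar> < e}
        \<le> inf (principal {y \<in> carrier_vec n. \<forall>k<n. \<bar>y $ k - x $ k\<bar> < a})
          (principal {y \<in> carrier_vec n. \<forall>k<n. \<bar>y $ k - x $ k\<bar> < b})"
      by (intro bexI[of _ "min a b"]) auto
  qed auto
  then show ?thesis by (auto simp: eventually_principal Bex_def Ball_def imp_conjL)
qed

lemma tendsto_coord_nhds:
  assumes "k < n"
  shows "((\<lambda>y. y $ k) \<longlongrightarrow> x $ k) (coord_nhds n x)"
  unfolding tendsto_iff eventually_coord_nhds dist_real_def using assms by blast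

lemma filterlim_coord_nhds:
  assumes "\<And>t. g t \<in> carrier_vec n" and "\<And>k. k < n \<Longrightarrow> ((\<lambda>t. g t $ k) \<longlongrightarrow> x $ k) F"
  shows "filterlim g (coord_nhds n x) F"
  unfolding filterlim_iff eventually_coord_nhds
proof (intro allI impI, elim exE conjE)
  fix P and \<epsilon> :: real
  assume "0 < \<epsilon>" and P: "\<forall>y\<in>carrier_vec n. (\<forall>k<n. \<bar>y $ k - x $ k\<bar> < \<epsilon>) \<longrightarrow> P y"
  then have "\<forall>\<^sub>F t in F. \<forall>k\<in>{..<n}. \<bar>g t $ k - x $ k\<bar> < \<epsilon>"
    using assms(2) by (intro eventually_ball_finite) (auto simp: tendsto_iff dist_real_def)
  then show "\<forall>\<^sub>F t in F. P (g t)"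
    by eventually_elim (use P assms(1) in auto)
qed

lemma tendsto_det:
  fixes A :: "'b \<Rightarrow> real mat"
  assumes "\<And>y. A y \<in> carrier_mat n n" and "B \<in> carrier_mat n n"
    and "\<And>i j. i < n \<Longrightarrow> j < n \<Longrightarrow> ((\<lambda>y. A y $$ (i, j)) \<longlongrightarrow> B $$ (i, j)) F"
  shows "((\<lambda>y. det (A y)) \<longlongrightarrow> det B) F"
  unfolding det_def'[OF assms(1)] det_def'[OF assms(2)]
  using assms(3) by (intro tendsto_intros) (auto dest: permutes_in_image)

text \<open>By the Leibniz formula the determinant is a finite sum of products of entries. Only the
  existence of a derivative is recorded, because the tangent subspace is computed from the defining
  equations and not from Cramer's formula.\<close>

lemma differentiable_det:
  fixes A :: "real \<Rightarrow> real mat"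
  assumes "\<And>t. A t \<in> carrier_mat n n"
    and "\<And>i j. i < n \<Longrightarrow> j < n \<Longrightarrow> \<exists>D. ((\<lambda>t. A t $$ (i, j)) has_real_derivative D) (at x)"
  shows "\<exists>D. ((\<lambda>t. det (A t)) has_real_derivative D) (at x)"
proof -
  from assms(2) obtain D where D: "\<And>i j. i < n \<Longrightarrow> j < n \<Longrightarrow>
      ((\<lambda>t. A t $$ (i, j)) has_real_derivative D i j) (at x)"
    by metis
  have "\<exists>E. ((\<lambda>t. signof p * (\<Prod>i = 0..<n. A t $$ (i, p i))) has_real_derivative E) (at x)"
    if "p permutes {0..<n}" for p
    by (rule exI, rule DERIV_cmult, rule has_field_derivative_prod, rule D)
      (use that in \<open>auto dest: permutes_in_image\<close>)
  then have "\<forall>p\<in>{p. p permutes {0..<n}}.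
      \<exists>E. ((\<lambda>t. signof p * (\<Prod>i = 0..<n. A t $$ (i, p i))) has_real_derivative E) (at x)"
    by simp
  from bchoice[OF this] obtain E where "\<And>p. p permutes {0..<n} \<Longrightarrow>
      ((\<lambda>t. signof p * (\<Prod>i = 0..<n. A t $$ (i, p i))) has_real_derivative E p) (at x)"
    by auto
  then have "((\<lambda>t. \<Sum>p | p permutes {0..<n}. signof p * (\<Prod>i = 0..<n. A t $$ (i, p i)))
      has_real_derivative (\<Sum>p | p permutes {0..<n}. E p)) (at x)"
    by (intro DERIV_sum) auto
  then show ?thesis unfolding det_def'[OF assms(1)] by blast
qed

section \<open>The base point and the solution around it\<close>

lemma subvec_index_I_carrier:
  "\<tau> \<le> r \<Longrightarrow> r \<le> N \<Longrightarrow> subvec T (index_I N r \<tau>) \<in> carrier_vec r"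
  by (simp add: subvec_index_I)

lemma subvec_index_K_carrier:
  "\<tau> \<le> r \<Longrightarrow> subvec a (index_K r \<tau>) \<in> carrier_vec r"
  by (simp add: subvec_index_K)

lemma vec_first_last_append:
  assumes "u \<in> carrier_vec r" and "v \<in> carrier_vec r"
  shows "vec_first (u @\<^sub>v v) r = u" and "vec_last (u @\<^sub>v v) r = v"
  using assms by (auto simp: vec_first_def vec_last_def intro!: eq_vecI)

lemma insert_minus1_subvec:
  assumes "a \<in> carrier_vec (Suc r)" and "\<tau> \<le> r" and "a $ \<tau> = -1"
  shows "insert_minus1 r \<tau> (subvec a (index_K r \<tau>)) = a"
  using assms by (intro eq_vecI) (auto simp: insert_minus1_def subvec_index_K)

lemma param_point:
  assumes S: "S \<in> rank_series N r" and "r < N" and "\<tau> \<le> r"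
    and a: "a \<in> carrier_vec (Suc r)" "a $ \<tau> = -1" "governed a S"
    and x: "x = subvec S (index_I N r \<tau>) @\<^sub>v subvec a (index_K r \<tau>)"
  shows "x \<in> carrier_vec (2 * r)" and "param_series N r \<tau> x S"
    and "i \<le> r \<Longrightarrow> glrr_coeff r \<tau> x i = a $ i"
proof -
  have cI: "subvec S (index_I N r \<tau>) \<in> carrier_vec r"
    and cK: "subvec a (index_K r \<tau>) \<in> carrier_vec r"
    using assms by (simp_all add: subvec_index_I_carrier subvec_index_K_carrier)
  show xc: "x \<in> carrier_vec (2 * r)"
    using append_carrier_vec[OF cI cK] by (simp add: x mult_2)
  have ins: "insert_minus1 r \<tau> (vec_last x r) = a"
    using insert_minus1_subvec[OF a(1) \<open>\<tau> \<le> r\<close> a(2)] by (simp add: x vec_first_last_append[OF cI cK])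
  show "param_series N r \<tau> x S"
    unfolding param_series_def ins using S a by (simp add: x vec_first_last_append[OF cI cK])
  show "glrr_coeff r \<tau> x i = a $ i" if "i \<le> r"
    using insert_minus1_vec_last[OF xc \<open>\<tau> \<le> r\<close>] ins that by (metis index_vec less_Suc_eq_le)
qed

lemma tendsto_glrr_coeff:
  assumes "\<tau> \<le> r" and "i \<le> r"
  shows "((\<lambda>y. glrr_coeff r \<tau> y i) \<longlongrightarrow> glrr_coeff r \<tau> x i) (coord_nhds (2 * r) x)"
  using assms by (auto simp: glrr_coeff_def intro!: tendsto_coord_nhds)

lemma tendsto_glrr_matrix:
  assumes "\<tau> \<le> r" and "r < N" and "i < N" and "j < N"
  shows "((\<lambda>y. glrr_matrix N r \<tau> y $$ (i, j)) \<longlongrightarrow> glrr_matrix N r \<tau> x $$ (i, j))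
    (coord_nhds (2 * r) x)"
  using assms by (auto simp: glrr_matrix_def intro!: tendsto_glrr_coeff)

lemma tendsto_glrr_rhs:
  assumes "r < N" and "i < N"
  shows "((\<lambda>y. glrr_rhs N r y $ i) \<longlongrightarrow> glrr_rhs N r x $ i) (coord_nhds (2 * r) x)"
  using assms by (auto simp: glrr_rhs_def intro!: tendsto_coord_nhds)

lemma replace_col_carrier [simp]:
  "A \<in> carrier_mat n m \<Longrightarrow> replace_col A b k \<in> carrier_mat n m"
  by (auto simp: replace_col_def)

lemma replace_col_index:
  "A \<in> carrier_mat n m \<Longrightarrow> i < n \<Longrightarrow> j < m \<Longrightarrow>
    replace_col A b k $$ (i, j) = (if j = k then b $ i else A $$ (i, j))"
  by (auto simp: replace_col_def)

lemma tendsto_glrr_solution: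
  assumes "\<tau> \<le> r" and "r < N" and "k < N" and "det (glrr_matrix N r \<tau> x) \<noteq> 0"
  shows "((\<lambda>y. glrr_solution N r \<tau> y $ k) \<longlongrightarrow> glrr_solution N r \<tau> x $ k)
    (coord_nhds (2 * r) x)"
proof -
  have "((\<lambda>y. det (replace_col (glrr_matrix N r \<tau> y) (glrr_rhs N r y) k)) \<longlongrightarrow>
      det (replace_col (glrr_matrix N r \<tau> x) (glrr_rhs N r x) k)) (coord_nhds (2 * r) x)"
    by (rule tendsto_det[where n = N])
      (use assms in \<open>auto simp: replace_col_index[OF glrr_matrix_carrier]
         intro: tendsto_glrr_matrix tendsto_glrr_rhs\<close>)
  moreover have "((\<lambda>y. det (glrr_matrix N r \<tau> y)) \<longlongrightarrow> det (glrr_matrix N r \<tau> x)) (coord_nhds (2 * r) x)"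
    by (rule tendsto_det[where n = N]) (use assms in \<open>auto intro: tendsto_glrr_matrix\<close>)
  ultimately show ?thesis
    using assms by (auto simp: glrr_solution_def intro!: tendsto_divide)
qed

lemma line_index:
  fixes x :: "real vec"
  assumes "x \<in> carrier_vec n" and "k < n"
  shows "(x + t \<cdot>\<^sub>v unit_vec n j) $ k = x $ k + t * (if k = j then 1 else 0)"
  using assms by (auto simp: unit_vec_def)

lemma has_derivative_line:
  fixes x :: "real vec"
  assumes "x \<in> carrier_vec n" and "k < n"
  shows "((\<lambda>t. (x + t \<cdot>\<^sub>v unit_vec n j) $ k) has_real_derivative (if k = j then 1 else 0)) (at 0)"
  unfolding line_index[OF assms] by (auto intro!: derivative_eq_intros)

text \<open>Carries what holds near \<open>x\<close> over to small t on a coordinate line, along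
  which \<open>has_jacobian\<close> differentiates. The filter at 0 is unpunctured, since functions
  to be exchanged under a derivative must also agree at t = 0.\<close>

lemma filterlim_line:
  fixes x :: "real vec"
  assumes x: "x \<in> carrier_vec n"
  shows "filterlim (\<lambda>t. x + t \<cdot>\<^sub>v unit_vec n j) (coord_nhds n x) (nhds 0)"
proof (rule filterlim_coord_nhds)
  fix k assume "k < n"
  have "((\<lambda>t::real. x $ k + t * (if k = j then 1 else 0)) \<longlongrightarrow> x $ k + 0 * (if k = j then 1 else 0)) (nhds 0)"
    by (intro tendsto_intros filterlim_ident)
  then show "((\<lambda>t. (x + t \<cdot>\<^sub>v unit_vec n j) $ k) \<longlongrightarrow> x $ k) (nhds 0)"
    by (simp add: line_index[OF x \<open>k < n\<close>])
qed (use x in auto)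

lemma differentiable_glrr_matrix:
  assumes x: "x \<in> carrier_vec (2 * r)" and "\<tau> \<le> r" and "r < N" and "i < N" and "k < N"
  shows "\<exists>D. ((\<lambda>t. glrr_matrix N r \<tau> (x + t \<cdot>\<^sub>v unit_vec (2 * r) j) $$ (i, k)) has_real_derivative D) (at 0)"
proof -
  have *: "\<exists>D. ((\<lambda>t. glrr_coeff r \<tau> (x + t \<cdot>\<^sub>v unit_vec (2 * r) j) l) has_real_derivative D) (at 0)"
    if "l \<le> r" for l
  proof (cases l \<tau> rule: linorder_cases)
    case less
    then have "(\<lambda>t. glrr_coeff r \<tau> (x + t \<cdot>\<^sub>v unit_vec (2 * r) j) l) = (\<lambda>t. (x + t \<cdot>\<^sub>v unit_vec (2 * r) j) $ (r + l))"
      by (simp add: glrr_coeff_def)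
    moreover have "r + l < 2 * r" using less assms by simp
    ultimately show ?thesis using has_derivative_line[OF x] by metis
  next
    case equal
    then show ?thesis by (auto simp: glrr_coeff_def intro: DERIV_const)
  next
    case greater
    then have "(\<lambda>t. glrr_coeff r \<tau> (x + t \<cdot>\<^sub>v unit_vec (2 * r) j) l) = (\<lambda>t. (x + t \<cdot>\<^sub>v unit_vec (2 * r) j) $ (r + (l - 1)))"
      by (simp add: glrr_coeff_def)
    moreover have "r + (l - 1) < 2 * r" using greater that by simp
    ultimately show ?thesis using has_derivative_line[OF x] by metis
  qed
  show ?thesis
  proof (cases "i < N - r \<and> i \<le> k \<and> k \<le> i + r")
    case True
    then have "(\<lambda>t. glrr_matrix N r \<tau> (x + t \<cdot>\<^sub>v unit_vec (2 * r) j) $$ (i, k))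
        = (\<lambda>t. glrr_coeff r \<tau> (x + t \<cdot>\<^sub>v unit_vec (2 * r) j) (k - i))"
      using assms by (simp add: glrr_matrix_def)
    moreover have "k - i \<le> r" using True by auto
    ultimately show ?thesis using * by metis
  next
    case False
    then have "(\<lambda>t. glrr_matrix N r \<tau> (x + t \<cdot>\<^sub>v unit_vec (2 * r) j) $$ (i, k))
        = (\<lambda>t. glrr_matrix N r \<tau> x $$ (i, k))"
      using assms by (auto simp: glrr_matrix_def)
    then show ?thesis by (metis DERIV_const)
  qed
qed

lemma differentiable_glrr_solution:
  assumes x: "x \<in> carrier_vec (2 * r)" and "\<tau> \<le> r" and "r < N" and "k < N"
    and det: "det (glrr_matrix N r \<tau> x) \<noteq> 0"
  shows "\<exists>D. ((\<lambda>t. glrr_solution N r \<tau> (x + t \<cdot>\<^sub>v unit_vec (2 * r) j) $ k) has_real_derivative D) (at 0)"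
proof -
  let ?g = "\<lambda>t. x + t \<cdot>\<^sub>v unit_vec (2 * r) j"
  have rhs: "\<exists>D. ((\<lambda>t. glrr_rhs N r (?g t) $ i) has_real_derivative D) (at 0)" if "i < N" for i
  proof (cases "i < N - r")
    case True
    then show ?thesis using that by (auto simp: glrr_rhs_def intro: DERIV_const)
  next
    case False
    then have "(\<lambda>t. glrr_rhs N r (?g t) $ i) = (\<lambda>t. ?g t $ (i - (N - r)))"
      using that by (simp add: glrr_rhs_def)
    moreover have "i - (N - r) < 2 * r" using False that \<open>r < N\<close> by simp
    ultimately show ?thesis using has_derivative_line[OF x] by metis
  qed
  have "\<exists>D. ((\<lambda>t. det (replace_col (glrr_matrix N r \<tau> (?g t)) (glrr_rhs N r (?g t)) k)) has_real_derivative D) (at 0)"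
  proof (rule differentiable_det[where n = N])
    fix i l assume "i < N" "l < N"
    then show "\<exists>D. ((\<lambda>t. replace_col (glrr_matrix N r \<tau> (?g t)) (glrr_rhs N r (?g t)) k $$ (i, l)) has_real_derivative D) (at 0)"
      using differentiable_glrr_matrix[OF x \<open>\<tau> \<le> r\<close> \<open>r < N\<close>] rhs
      by (cases "l = k") (simp_all only: replace_col_index[OF glrr_matrix_carrier] simp_thms if_True if_False)
  qed simp
  moreover have "\<exists>D. ((\<lambda>t. det (glrr_matrix N r \<tau> (?g t))) has_real_derivative D) (at 0)"
    by (rule differentiable_det[where n = N])
      (use differentiable_glrr_matrix[OF x \<open>\<tau> \<le> r\<close> \<open>r < N\<close>] in auto)
  moreover have "?g 0 = x" using x by (intro eq_vecI) auto
  then have "det (glrr_matrix N r \<tau> (?g 0)) \<noteq> 0" using det by simp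
  ultimately have "\<exists>D. ((\<lambda>t. det (replace_col (glrr_matrix N r \<tau> (?g t)) (glrr_rhs N r (?g t)) k)
      / det (glrr_matrix N r \<tau> (?g t))) has_real_derivative D) (at 0)"
    using DERIV_divide by blast
  then show ?thesis using \<open>k < N\<close> by (simp add: glrr_solution_def)
qed

text \<open>Two determinants are continuous and nonzero at \<open>x\<close>: that of the system
  gives a unique linear solution nearby, and the bordered one, with columns chosen once at
  \<open>x\<close>, keeps the rank of that solution equal to r.\<close>

lemma eventually_param_series:
  assumes x: "x \<in> carrier_vec (2 * r)" and "\<tau> \<le> r" and "r < N"
    and par: "param_series N r \<tau> x S" and det: "det (glrr_matrix N r \<tau> x) \<noteq> 0"
  shows "\<forall>\<^sub>F y in coord_nhds (2 * r) x.
    param_series N r \<tau> y (glrr_solution N r \<tau> y) \<and> (\<exists>!T. param_series N r \<tau> y T)"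
proof -
  let ?F = "coord_nhds (2 * r) x"
  have S: "S \<in> rank_series N r" "glrr_matrix N r \<tau> x *\<^sub>v S = glrr_rhs N r x" 
    using par param_series_iff[OF x \<open>\<tau> \<le> r\<close> \<open>r < N\<close>] by auto
  then have Sc: "S \<in> carrier_vec N" by (simp add: rank_series_def)
  have sol: "glrr_solution N r \<tau> x = S"
    using glrr_solution_unique[OF det Sc S(2)] by simp
  have b: "vec (Suc r) (glrr_coeff r \<tau> y) \<in> carrier_vec (Suc r)"
    "vec (Suc r) (glrr_coeff r \<tau> y) \<noteq> 0\<^sub>v (Suc r)" for y
  proof -
    have "vec (Suc r) (glrr_coeff r \<tau> y) $ \<tau> = -1" using \<open>\<tau> \<le> r\<close> by (simp add: glrr_coeff_def)
    then show "vec (Suc r) (glrr_coeff r \<tau> y) \<noteq> 0\<^sub>v (Suc r)" using \<open>\<tau> \<le> r\<close>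
      by (metis index_zero_vec(1) less_Suc_eq_le neg_equal_0_iff_equal zero_neq_one)
  qed simp
  \<comment> \<open>The border varies with \<open>y\<close>: the rank criterion at \<open>y\<close>
    needs a recurrence that governs the solution at \<open>y\<close>.\<close>
  let ?M = "\<lambda>c y. mat (Suc r) (Suc r) (\<lambda>(i, j). if j < r then glrr_solution N r \<tau> y $ (i + c j)
    else vec (Suc r) (glrr_coeff r \<tau> y) $ i)"
  have gov: "governed (vec (Suc r) (glrr_coeff r \<tau> x)) S"
    using par unfolding param_series_def insert_minus1_vec_last[OF x \<open>\<tau> \<le> r\<close>] by blast
  have "\<exists>c. (\<forall>j<r. c j < N - r) \<and> det (?M c x) \<noteq> 0"
    using iffD1[OF rank_series_iff_bordered_det[OF b Sc \<open>r < N\<close> gov] S(1)] unfolding sol .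
  then obtain c where c: "\<forall>j<r. c j < N - r" and Mx: "det (?M c x) \<noteq> 0"
    by (elim exE conjE)
  have "((\<lambda>y. det (glrr_matrix N r \<tau> y)) \<longlongrightarrow> det (glrr_matrix N r \<tau> x)) ?F"
    by (rule tendsto_det[where n = N]) (use assms in \<open>auto intro: tendsto_glrr_matrix\<close>)
  then have "\<forall>\<^sub>F y in ?F. det (glrr_matrix N r \<tau> y) \<noteq> 0"
    using det by (rule tendsto_imp_eventually_ne)
  moreover have "((\<lambda>y. det (?M c y)) \<longlongrightarrow> det (?M c x)) ?F"
  proof (rule tendsto_det[where n = "Suc r"])
    fix i j assume ij: "i < Suc r" "j < Suc r"
    show "((\<lambda>y. ?M c y $$ (i, j)) \<longlongrightarrow> ?M c x $$ (i, j)) ?F"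
    proof (cases "j < r")
      case True
      then have "i + c j < N" using ij c[rule_format, of j] by simp
      then show ?thesis
        using True ij tendsto_glrr_solution[OF \<open>\<tau> \<le> r\<close> \<open>r < N\<close> _ det] by simp
    next
      case False
      then show ?thesis using ij tendsto_glrr_coeff[OF \<open>\<tau> \<le> r\<close>] by simp
    qed
  qed simp_all
  then have "\<forall>\<^sub>F y in ?F. det (?M c y) \<noteq> 0"
    using Mx by (rule tendsto_imp_eventually_ne)
  moreover have "\<forall>\<^sub>F y in ?F. y \<in> carrier_vec (2 * r)"
    unfolding eventually_coord_nhds by (intro exI[of _ 1]) simp
  ultimately show ?thesis
  proof eventually_elim
    case (elim y)
    note eq = glrr_matrix_solution[OF elim(1)]
    have "(\<Sum>i\<le>r. glrr_coeff r \<tau> y i * glrr_solution N r \<tau> y $ (k + i)) = 0" if "k < N - r" for k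
      using glrr_matrix_mult_upper[OF glrr_solution_carrier \<open>r < N\<close> that, of \<tau> y r \<tau> y] that
      unfolding eq by (simp add: glrr_rhs_def)
    then have "governed (vec (Suc r) (glrr_coeff r \<tau> y)) (glrr_solution N r \<tau> y)"
      using governed_iff[OF b(1) glrr_solution_carrier \<open>r < N\<close>] by simp
    from iffD2[OF rank_series_iff_bordered_det[OF b glrr_solution_carrier \<open>r < N\<close> this], OF exI, OF conjI, OF c elim(2)]
    have "glrr_solution N r \<tau> y \<in> rank_series N r" .
    then have "param_series N r \<tau> y (glrr_solution N r \<tau> y)"
      using param_series_iff[OF elim(3) \<open>\<tau> \<le> r\<close> \<open>r < N\<close>] eq by blast
    moreover have "T = glrr_solution N r \<tau> y" if "param_series N r \<tau> y T" for T
      using that param_series_iff[OF elim(3) \<open>\<tau> \<le> r\<close> \<open>r < N\<close>] glrr_solution_unique[OF elim(1)]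
      by (auto simp: rank_series_def)
    ultimately show ?case by blast
  qed
qed

section \<open>Existence of a tangent subspace\<close>

lemma last_nonzero_entry:
  assumes "a \<in> carrier_vec (Suc r)" and "a \<noteq> 0\<^sub>v (Suc r)"
  obtains p where "p \<le> r" and "a $ p \<noteq> 0" and "\<And>i. p < i \<Longrightarrow> i \<le> r \<Longrightarrow> a $ i = 0"
proof -
  define I where "I = {i. i \<le> r \<and> a $ i \<noteq> 0}"
  have I: "finite I" "I \<noteq> {}"
    using assms by (auto simp: I_def vec_eq_iff less_Suc_eq_le)
  show thesis
  proof (rule that)
    fix i assume "Max I < i" "i \<le> r"
    then have "i \<notin> I" using Max_ge[OF I(1), of i] by auto
    then show "a $ i = 0" using \<open>i \<le> r\<close> by (simp add: I_def)
  qed (use Max_in[OF I] in \<open>auto simp: I_def\<close>)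
qed

lemma is_tangent_subspace_exists:
  assumes S: "S \<in> rank_series N r" and "r < N"
    and a: "a \<in> carrier_vec (Suc r)" "a \<noteq> 0\<^sub>v (Suc r)" "governed a S"
  shows "\<exists>V. is_tangent_subspace N r S V"
proof -
  have Sc: "S \<in> carrier_vec N" using S by (simp add: rank_series_def)
  obtain \<tau> where "\<tau> \<le> r" and a\<tau>: "a $ \<tau> \<noteq> 0" and top: "\<And>i. \<tau> < i \<Longrightarrow> i \<le> r \<Longrightarrow> a $ i = 0"
    by (rule last_nonzero_entry[OF a(1,2)]) (rule that; assumption)
  define b where "b = (- 1 / a $ \<tau>) \<cdot>\<^sub>v a"
  have b: "b \<in> carrier_vec (Suc r)" "b $ \<tau> = -1"
    using a \<open>\<tau> \<le> r\<close> a\<tau> by (auto simp: b_def)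
  have bi: "b $ i = - 1 / a $ \<tau> * a $ i" if "i \<le> r" for i
    using that a by (simp add: b_def)
  have "(\<Sum>i\<le>r. b $ i * S $ (k + i)) = - 1 / a $ \<tau> * (\<Sum>i\<le>r. a $ i * S $ (k + i))" for k
    by (simp add: bi sum_distrib_left mult.assoc)
  then have "governed b S"
    using a(3) by (simp add: governed_iff[OF b(1) Sc \<open>r < N\<close>] governed_iff[OF a(1) Sc \<open>r < N\<close>])
  define x where "x = subvec S (index_I N r \<tau>) @\<^sub>v subvec b (index_K r \<tau>)"
  note pp = param_point[OF S \<open>r < N\<close> \<open>\<tau> \<le> r\<close> b \<open>governed b S\<close> x_def]
  have det: "det (glrr_matrix N r \<tau> x) \<noteq> 0"
    by (rule det_glrr_matrix_nonzero[OF \<open>\<tau> \<le> r\<close> \<open>r < N\<close>]) (simp add: pp(3) bi top)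
  note ev = eventually_param_series[OF pp(1) \<open>\<tau> \<le> r\<close> \<open>r < N\<close> pp(2) det]
  have near: "S_map_defined_near N r \<tau> x"
    unfolding S_map_defined_near_def eventually_coord_nhds[symmetric]
    using ev by (rule eventually_mono) simp
  have "\<exists>D. ((\<lambda>t. S_map N r \<tau> (x + t \<cdot>\<^sub>v unit_vec (2 * r) j) $ i) has_real_derivative D) (at 0)"
    if iN: "i < N" for i j
  proof -
    obtain D where D: "((\<lambda>t. glrr_solution N r \<tau> (x + t \<cdot>\<^sub>v unit_vec (2 * r) j) $ i) has_real_derivative D) (at 0)"
      using differentiable_glrr_solution[OF pp(1) \<open>\<tau> \<le> r\<close> \<open>r < N\<close> iN det] by blast
    \<comment> \<open>Near \<open>x\<close> the series chosen by \<open>THE\<close> is the Cramer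
      solution, which hands its derivatives over to \<open>S_map\<close>.\<close>
    have "\<forall>\<^sub>F y in coord_nhds (2 * r) x. glrr_solution N r \<tau> y $ i = S_map N r \<tau> y $ i"
      using ev by eventually_elim (metis S_map_def the1_equality)
    then have "\<forall>\<^sub>F t in nhds 0. glrr_solution N r \<tau> (x + t \<cdot>\<^sub>v unit_vec (2 * r) j) $ i
        = S_map N r \<tau> (x + t \<cdot>\<^sub>v unit_vec (2 * r) j) $ i"
      using filterlim_line[OF pp(1)] by (rule eventually_compose_filterlim)
    from DERIV_cong_ev[OF refl this refl] D show ?thesis by blast
  qed
  then obtain D where D: "\<And>i j. i < N \<Longrightarrow>
      ((\<lambda>t. S_map N r \<tau> (x + t \<cdot>\<^sub>v unit_vec (2 * r) j) $ i) has_real_derivative D i j) (at 0)"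
    by metis
  have "has_jacobian N (2 * r) (S_map N r \<tau>) (mat N (2 * r) (\<lambda>(i, j). D i j)) x"
    by (simp add: has_jacobian_def D)
  then show ?thesis
    unfolding is_tangent_subspace_def
    using \<open>\<tau> \<le> r\<close> b \<open>governed b S\<close> x_def near by (metis Suc_eq_plus1 less_Suc_eq_le)
qed

section \<open>Columns of the Jacobian\<close>

text \<open>Both identities are derivatives at t = 0 of the equations in
  \<open>param_series\<close>: the product rule for the recurrence, and the prescribed entries. The
  factor in front of \<open>S\<close> is the derivative of \<open>glrr_coeff\<close>, zero at
  \<open>\<tau>\<close> where the coefficient stays -1. No formula for \<open>S_map\<close> enters,
  so any admissible \<open>\<tau>\<close> is covered.\<close>

lemma jacobian_column:
  assumes S: "S \<in> rank_series N r" and "r < N" and "\<tau> \<le> r"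
    and a: "a \<in> carrier_vec (Suc r)" "a $ \<tau> = -1" "governed a S"
    and x: "x = subvec S (index_I N r \<tau>) @\<^sub>v subvec a (index_K r \<tau>)"
    and near: "S_map_defined_near N r \<tau> x"
    and jac: "has_jacobian N (2 * r) (S_map N r \<tau>) J x"
    and j: "j < 2 * r"
  shows "k < N - r \<Longrightarrow> (\<Sum>i\<le>r. a $ i * J $$ (k + i, j)) =
      - (\<Sum>i\<le>r. (if i = \<tau> then 0 else unit_vec (2 * r) j $ (if i < \<tau> then r + i else r + (i - 1))) * S $ (k + i))"
    and "k < r \<Longrightarrow> J $$ (if k < \<tau> then k else k + (N - r), j) = unit_vec (2 * r) j $ k"
proof -
  let ?g = "\<lambda>t. x + t \<cdot>\<^sub>v unit_vec (2 * r) j"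
  let ?T = "\<lambda>t. S_map N r \<tau> (?g t)"
  note pp = param_point[OF S \<open>r < N\<close> \<open>\<tau> \<le> r\<close> a x]
  have g0: "?g 0 = x" using pp(1) by (intro eq_vecI) auto
  have gc: "?g t \<in> carrier_vec (2 * r)" for t using pp(1) by simp
  have ev: "\<forall>\<^sub>F y in coord_nhds (2 * r) x. \<exists>!T. param_series N r \<tau> y T"
    using near unfolding S_map_defined_near_def eventually_coord_nhds .
  have "\<exists>!T. param_series N r \<tau> x T"
    using near pp(1) unfolding S_map_defined_near_def by auto
  \<comment> \<open>Uniqueness at \<open>x\<close> itself identifies the base value, at which the
    product rule is evaluated below.\<close>
  then have T0: "?T 0 = S"
    unfolding g0 S_map_def using pp(2) by (rule the1_equality)
  have "\<forall>\<^sub>F t in nhds 0. \<exists>!T. param_series N r \<tau> (?g t) T"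
    using ev filterlim_line[OF pp(1)] by (rule eventually_compose_filterlim)
  then have par: "\<forall>\<^sub>F t in nhds 0. param_series N r \<tau> (?g t) (?T t)"
    unfolding S_map_def by (rule eventually_mono) (rule theI')
  have dT: "((\<lambda>t. ?T t $ i) has_real_derivative J $$ (i, j)) (at 0)" if "i < N" for i
    using jac j that by (simp add: has_jacobian_def)
  have line: "((\<lambda>t. ?g t $ i) has_real_derivative unit_vec (2 * r) j $ i) (at 0)" if "i < 2 * r" for i
    using has_derivative_line[OF pp(1) that, of j] that j by (simp add: unit_vec_def)
  { assume k: "k < N - r"
    have dc: "((\<lambda>t. glrr_coeff r \<tau> (?g t) i) has_real_derivative
        (if i = \<tau> then 0 else unit_vec (2 * r) j $ (if i < \<tau> then r + i else r + (i - 1)))) (at 0)"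
      if "i \<le> r" for i
    proof (cases i \<tau> rule: linorder_cases)
      case less
      then have "(\<lambda>t. glrr_coeff r \<tau> (?g t) i) = (\<lambda>t. ?g t $ (r + i))" by (simp only: glrr_coeff_def if_True)
      then show ?thesis using less line[of "r + i"] \<open>\<tau> \<le> r\<close> by simp
    next
      case equal
      then show ?thesis by (simp add: glrr_coeff_def)
    next
      case greater
      then have "(\<lambda>t. glrr_coeff r \<tau> (?g t) i) = (\<lambda>t. ?g t $ (r + (i - 1)))"
        unfolding glrr_coeff_def by auto
      then show ?thesis using greater line[of "r + (i - 1)"] that by simp
    qed
    have "\<forall>\<^sub>F t in nhds 0. (\<Sum>i\<le>r. glrr_coeff r \<tau> (?g t) i * ?T t $ (k + i)) = 0"
      using par
    proof eventually_elim
      case (elim t)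
      then have "?T t \<in> carrier_vec N" by (simp add: param_series_def rank_series_def)
      then show ?case
        using elim governed_insert_minus1_iff[OF gc \<open>\<tau> \<le> r\<close> \<open>r < N\<close>] k unfolding param_series_def by blast
    qed
    \<comment> \<open>The recurrence sum is constantly 0 near t = 0. Equating this derivative with
      the one from the product rule gives the linearized recurrence.\<close>
    then have "((\<lambda>t. \<Sum>i\<le>r. glrr_coeff r \<tau> (?g t) i * ?T t $ (k + i)) has_real_derivative 0) (at 0)"
      using DERIV_cong_ev[of 0 0 "\<lambda>t. \<Sum>i\<le>r. glrr_coeff r \<tau> (?g t) i * ?T t $ (k + i)" "\<lambda>t. 0" 0 0] by simp
    moreover have "((\<lambda>t. \<Sum>i\<le>r. glrr_coeff r \<tau> (?g t) i * ?T t $ (k + i)) has_real_derivative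
      (\<Sum>i\<le>r. (if i = \<tau> then 0 else unit_vec (2 * r) j $ (if i < \<tau> then r + i else r + (i - 1))) * S $ (k + i)
        + J $$ (k + i, j) * a $ i)) (at 0)"
    proof (rule DERIV_sum)
      fix i assume "i \<in> {..r}"
      then have i: "i \<le> r" "k + i < N" using k by auto
      have "?T 0 $ (k + i) = S $ (k + i)" "glrr_coeff r \<tau> (?g 0) i = a $ i"
        using T0 g0 pp(3)[OF i(1)] by simp_all
      then show "((\<lambda>t. glrr_coeff r \<tau> (?g t) i * ?T t $ (k + i)) has_real_derivative
        ((if i = \<tau> then 0 else unit_vec (2 * r) j $ (if i < \<tau> then r + i else r + (i - 1))) * S $ (k + i)
        + J $$ (k + i, j) * a $ i)) (at 0)"
        using DERIV_mult[OF dc[OF i(1)] dT[OF i(2)]] by simp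
    qed
    ultimately have "(\<Sum>i\<le>r. (if i = \<tau> then 0 else unit_vec (2 * r) j $ (if i < \<tau> then r + i else r + (i - 1))) * S $ (k + i)
        + J $$ (k + i, j) * a $ i) = 0"
      by (rule DERIV_unique[symmetric])
    then have "(\<Sum>i\<le>r. (if i = \<tau> then 0 else unit_vec (2 * r) j $ (if i < \<tau> then r + i else r + (i - 1))) * S $ (k + i))
        + (\<Sum>i\<le>r. J $$ (k + i, j) * a $ i) = 0" (is "?d + ?J = 0")
      by (simp only: sum.distrib)
    then have "?J = - ?d" by (simp only: add_eq_0_iff)
    moreover have "?J = (\<Sum>i\<le>r. a $ i * J $$ (k + i, j))"
      by (intro sum.cong refl) (rule mult.commute)
    ultimately show "(\<Sum>i\<le>r. a $ i * J $$ (k + i, j)) =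
      - (\<Sum>i\<le>r. (if i = \<tau> then 0 else unit_vec (2 * r) j $ (if i < \<tau> then r + i else r + (i - 1))) * S $ (k + i))"
      by (simp only:) }
  { assume k: "k < r"
    let ?p = "if k < \<tau> then k else k + (N - r)"
    have pN: "?p < N" using k \<open>\<tau> \<le> r\<close> \<open>r < N\<close> by auto
    have "\<forall>\<^sub>F t in nhds 0. ?T t $ ?p = ?g t $ k"
      using par
    proof eventually_elim
      case (elim t)
      then have "vec r (\<lambda>k. ?T t $ (if k < \<tau> then k else k + (N - r))) = vec_first (?g t) r"
        using \<open>\<tau> \<le> r\<close> \<open>r < N\<close> by (simp add: param_series_def subvec_index_I)
      then have "vec r (\<lambda>k. ?T t $ (if k < \<tau> then k else k + (N - r))) $ k = vec_first (?g t) r $ k"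
        by simp
      then show ?case using k by (simp add: vec_first_def)
    qed
    then have "((\<lambda>t. ?T t $ ?p) has_real_derivative unit_vec (2 * r) j $ k) (at 0)"
      using line[of k] k DERIV_cong_ev[of 0 0 "\<lambda>t. ?T t $ ?p" "\<lambda>t. ?g t $ k"] by simp
    then show "J $$ (?p, j) = unit_vec (2 * r) j $ k"
      using dT[OF pN] DERIV_unique by blast }
qed

section \<open>The tangent subspace as Z(a^2)\<close>

lemma glrr_space_self_convolution_iff:
  assumes "2 * r < N"
  shows "z \<in> glrr_space N (self_convolution r a) \<longleftrightarrow> z \<in> carrier_vec N \<and>
    (\<forall>k<N - 2 * r. (\<Sum>i\<le>r. a $ i * (\<Sum>l\<le>r. a $ l * z $ (k + i + l))) = 0)"
proof -
  have "self_convolution r a \<in> carrier_vec (Suc (2 * r))" by (simp add: self_convolution_def)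
  then have "governed (self_convolution r a) z \<longleftrightarrow>
    (\<forall>k<N - 2 * r. (\<Sum>i\<le>r. a $ i * (\<Sum>l\<le>r. a $ l * z $ (k + i + l))) = 0)" if "z \<in> carrier_vec N"
    using governed_iff[of "self_convolution r a" "2 * r" z N] that assms
    by (simp add: self_convolution_sum[of r a "\<lambda>i. z $ i"])
  then show ?thesis by (auto simp: glrr_space_def)
qed

text \<open>Each of the two factors contributes \<open>c\<close>, so the defining sums change by a
  nonzero square. This connects the normalized recurrence of a parameterization with an arbitrary
  nonzero one.\<close>

lemma glrr_space_self_convolution_smult:
  assumes "2 * r < N" and a: "a \<in> carrier_vec (Suc r)" and "c \<noteq> 0"
  shows "glrr_space N (self_convolution r (c \<cdot>\<^sub>v a)) = glrr_space N (self_convolution r a)"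
proof -
  have "(\<Sum>i\<le>r. (c \<cdot>\<^sub>v a) $ i * (\<Sum>l\<le>r. (c \<cdot>\<^sub>v a) $ l * z $ (k + i + l)))
      = c * c * (\<Sum>i\<le>r. a $ i * (\<Sum>l\<le>r. a $ l * z $ (k + i + l)))" for z k
    using a by (simp add: sum_distrib_left mult_ac)
  then show ?thesis
    using assms by (auto simp: glrr_space_self_convolution_iff simp del: index_smult_vec)
qed

lemma subspace_dim_col_space:
  assumes "J \<in> carrier_mat N n"
    and "\<And>v. v \<in> carrier_vec n \<Longrightarrow> J *\<^sub>v v = 0\<^sub>v N \<Longrightarrow> v = 0\<^sub>v n"
  shows "subspace_dim N (vec_space.col_space N J) = n"
proof -
  interpret vec_space "TYPE(real)" N .
  have "rank J = n"
    using lin_indpt_full_rank trivial_kernel_imp_distinct_lin_indpt assms by blast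
  then show ?thesis by (simp add: subspace_dim_def rank_def col_space_def)
qed

lemma tangent_subspace_eq_glrr_space:
  assumes S: "S \<in> rank_series N r" and "2 * r < N" and "\<tau> \<le> r"
    and a: "a \<in> carrier_vec (Suc r)" "a $ \<tau> = -1" "governed a S"
    and x: "x = subvec S (index_I N r \<tau>) @\<^sub>v subvec a (index_K r \<tau>)"
    and near: "S_map_defined_near N r \<tau> x"
    and jac: "has_jacobian N (2 * r) (S_map N r \<tau>) J x"
  shows "subspace_dim N (vec_space.col_space N J) = 2 * r"
    and "vec_space.col_space N J = glrr_space N (self_convolution r a)"
proof -
  interpret vec_space "TYPE(real)" N .
  have "r < N" using \<open>2 * r < N\<close> by simp
  have Sc: "S \<in> carrier_vec N" using S by (simp add: rank_series_def)
  have J: "J \<in> carrier_mat N (2 * r)" using jac by (simp add: has_jacobian_def)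
  have a0: "a \<noteq> 0\<^sub>v (Suc r)"
    using a(2) \<open>\<tau> \<le> r\<close> by (metis index_zero_vec(1) less_Suc_eq_le neg_equal_0_iff_equal zero_neq_one)
  have ga: "(\<Sum>i\<le>r. a $ i * S $ (k + i)) = 0" if "k < N - r" for k
    using a(3) that by (simp add: governed_iff[OF a(1) Sc \<open>r < N\<close>])
  note cols = jacobian_column[OF S \<open>r < N\<close> \<open>\<tau> \<le> r\<close> a x near jac]
  \<comment> \<open>\<open>q i\<close> is the position of the i-th recurrence coefficient in a
    parameter vector, and \<open>d v\<close> is the variation of the recurrence in direction
    \<open>v\<close>, with entry 0 at \<open>\<tau>\<close> because of the normalization.\<close>
  define q where "q = (\<lambda>i. if i < \<tau> then r + i else r + (i - 1))"
  define d where "d = (\<lambda>(v :: real vec) i. if i = \<tau> then 0 else v $ q i)"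
  have q: "q i < 2 * r" if "i \<le> r" "i \<noteq> \<tau>" for i
    using that \<open>\<tau> \<le> r\<close> by (auto simp: q_def)
  have Jv: "(J *\<^sub>v v) $ i = (\<Sum>j<2 * r. J $$ (i, j) * v $ j)"
    if "v \<in> carrier_vec (2 * r)" "i < N" for v i
    using mult_mat_vec_index_sum[OF J] that .
  have unit: "(\<Sum>j<2 * r. unit_vec (2 * r) j $ k * v $ j) = v $ k" if "k < 2 * r" for v :: "real vec" and k
  proof -
    have "(\<Sum>j<2 * r. unit_vec (2 * r) j $ k * v $ j) = (\<Sum>j<2 * r. if j = k then v $ j else 0)"
      using that by (intro sum.cong) auto
    then show ?thesis using that by simp
  qed
  have rec: "(\<Sum>i\<le>r. a $ i * (J *\<^sub>v v) $ (k + i)) = - (\<Sum>i\<le>r. d v i * S $ (k + i))"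
    if v: "v \<in> carrier_vec (2 * r)" and k: "k < N - r" for v k
  proof -
    have "(\<Sum>i\<le>r. a $ i * (J *\<^sub>v v) $ (k + i)) = (\<Sum>i\<le>r. \<Sum>j<2 * r. a $ i * J $$ (k + i, j) * v $ j)"
      using Jv[OF v] k by (intro sum.cong) (auto simp: sum_distrib_left mult.assoc)
    also have "\<dots> = (\<Sum>j<2 * r. (\<Sum>i\<le>r. a $ i * J $$ (k + i, j)) * v $ j)"
      by (subst sum.swap) (simp add: sum_distrib_right)
    also have "\<dots> = (\<Sum>j<2 * r. - (\<Sum>i\<le>r. d (unit_vec (2 * r) j) i * S $ (k + i)) * v $ j)"
      using k by (intro sum.cong refl) (simp only: cols(1) d_def q_def lessThan_iff)
    also have "\<dots> = - (\<Sum>j<2 * r. \<Sum>i\<le>r. d (unit_vec (2 * r) j) i * v $ j * S $ (k + i))"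
      by (simp add: sum_distrib_right sum_distrib_left sum_negf mult_ac)
    also have "\<dots> = - (\<Sum>i\<le>r. (\<Sum>j<2 * r. d (unit_vec (2 * r) j) i * v $ j) * S $ (k + i))"
      by (subst sum.swap) (simp add: sum_distrib_right)
    also have "\<dots> = - (\<Sum>i\<le>r. d v i * S $ (k + i))"
    proof -
      have "(\<Sum>j<2 * r. d (unit_vec (2 * r) j) i * v $ j) = d v i" if "i \<le> r" for i
        using unit[OF q[OF that]] by (cases "i = \<tau>") (simp_all add: d_def)
      then show ?thesis by simp
    qed
    finally show ?thesis .
  qed
  have pos: "(J *\<^sub>v v) $ (if k < \<tau> then k else k + (N - r)) = v $ k"
    if v: "v \<in> carrier_vec (2 * r)" and k: "k < r" for v k
  proof -
    let ?p = "if k < \<tau> then k else k + (N - r)"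
    have "?p < N" using k \<open>\<tau> \<le> r\<close> \<open>r < N\<close> by auto
    then have "(J *\<^sub>v v) $ ?p = (\<Sum>j<2 * r. J $$ (?p, j) * v $ j)" by (rule Jv[OF v])
    also have "\<dots> = (\<Sum>j<2 * r. unit_vec (2 * r) j $ k * v $ j)"
      using cols(2) k by (intro sum.cong refl) (simp only: lessThan_iff)
    also have "\<dots> = v $ k" using k by (intro unit) simp
    finally show ?thesis .
  qed
  have ker: "v = 0\<^sub>v (2 * r)" if v: "v \<in> carrier_vec (2 * r)" and 0: "J *\<^sub>v v = 0\<^sub>v N" for v
  proof -
    let ?c = "vec (Suc r) (d v)"
    have first: "v $ k = 0" if "k < r" for k
    proof -
      have "(if k < \<tau> then k else k + (N - r)) < N" using that \<open>\<tau> \<le> r\<close> \<open>r < N\<close> by auto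
      then show ?thesis using pos[OF v that] unfolding 0 by simp
    qed
    have "(\<Sum>i\<le>r. d v i * S $ (k + i)) = 0" if "k < N - r" for k
      using rec[OF v that] that unfolding 0 by simp
    then have "governed ?c S" by (simp add: governed_iff[OF _ Sc \<open>r < N\<close>])
    then obtain e where e: "?c = e \<cdot>\<^sub>v a"
      using governed_unique_up_to_scaling[OF S \<open>r < N\<close> a(1) a0 a(3), of ?c] by auto
    have ei: "d v i = e * a $ i" if "i \<le> r" for i
      using arg_cong[OF e, of "\<lambda>u. u $ i"] that a(1) by simp
    have "e = 0" using ei[OF \<open>\<tau> \<le> r\<close>] a(2) by (simp add: d_def)
    then have d0: "d v i = 0" if "i \<le> r" for i using ei that by simp
    \<comment> \<open>Position \<open>r + k\<close> holds coefficient k if k lies below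
      \<open>\<tau>\<close>, and coefficient k + 1 otherwise.\<close>
    have last: "v $ (r + k) = 0" if "k < r" for k
      using d0[of k] d0[of "k + 1"] that \<open>\<tau> \<le> r\<close>
      by (cases "k < \<tau>") (simp_all add: d_def q_def)
    have "v $ k = 0" if "k < 2 * r" for k
      using first[of k] last[of "k - r"] that by (cases "k < r") auto
    then show ?thesis using v by (intro eq_vecI) auto
  qed
  show "subspace_dim N (col_space J) = 2 * r"
    by (rule subspace_dim_col_space[OF J ker])
  have im: "J *\<^sub>v v \<in> glrr_space N (self_convolution r a)" if v: "v \<in> carrier_vec (2 * r)" for v
  proof -
    have "(\<Sum>i\<le>r. a $ i * (\<Sum>l\<le>r. a $ l * (J *\<^sub>v v) $ (k + i + l))) = 0" if k: "k < N - 2 * r" for k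
    proof -
      \<comment> \<open>The bound on k puts each \<open>k + i\<close> below \<open>N - r\<close>,
        where \<open>rec\<close> applies. After swapping the sums, \<open>a\<close> acts on
        \<open>S\<close> at \<open>k + l\<close>, which lies in the same range.\<close>
      have "(\<Sum>i\<le>r. a $ i * (\<Sum>l\<le>r. a $ l * (J *\<^sub>v v) $ (k + i + l)))
          = (\<Sum>i\<le>r. \<Sum>l\<le>r. - (d v l * (a $ i * S $ (k + l + i))))"
      proof (intro sum.cong refl)
        fix i assume "i \<in> {..r}"
        then have "k + i < N - r" using k by simp
        then show "a $ i * (\<Sum>l\<le>r. a $ l * (J *\<^sub>v v) $ (k + i + l))
            = (\<Sum>l\<le>r. - (d v l * (a $ i * S $ (k + l + i))))"
          unfolding rec[OF v \<open>k + i < N - r\<close>]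
          by (simp add: sum_distrib_left sum_negf mult_ac add_ac)
      qed
      also have "\<dots> = - (\<Sum>l\<le>r. d v l * (\<Sum>i\<le>r. a $ i * S $ (k + l + i)))"
        by (subst sum.swap) (simp add: sum_distrib_left sum_negf)
      also have "\<dots> = 0" using k by (simp add: ga)
      finally show ?thesis .
    qed
    moreover have "J *\<^sub>v v \<in> carrier_vec N" using J v by auto
    ultimately show ?thesis by (simp add: glrr_space_self_convolution_iff[OF \<open>2 * r < N\<close>])
  qed
  \<comment> \<open>The comparison of dimensions made concrete: 2r entries that determine an element
    of Z(a^2) select a square submatrix of \<open>J\<close>. It is invertible, so some
    \<open>J *\<^sub>v v\<close> agrees with z at these entries, hence everywhere.\<close>
  have sub: "glrr_space N (self_convolution r a) \<subseteq> (\<lambda>v. J *\<^sub>v v) ` carrier_vec (2 * r)"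
  proof
    fix z assume z: "z \<in> glrr_space N (self_convolution r a)"
    obtain p where p: "p \<le> r" "a $ p \<noteq> 0" and top: "\<And>i. p < i \<Longrightarrow> i \<le> r \<Longrightarrow> a $ i = 0"
      by (rule last_nonzero_entry[OF a(1) a0]) (rule that; assumption)
    \<comment> \<open>The 2r indices are those outside the window of length \<open>N - 2 * r\<close>
      that starts at \<open>2 * p\<close>. Here \<open>p\<close> may be larger than
      \<open>\<tau>\<close>.\<close>
    have vanish: "w = 0\<^sub>v N" if w: "w \<in> glrr_space N (self_convolution r a)"
      and out: "\<And>k. k < 2 * r \<Longrightarrow> w $ (if k < 2 * p then k else k + (N - 2 * r)) = 0" for w
    proof -
      have wc: "w \<in> carrier_vec N" using w by (simp add: glrr_space_def)
      have "w $ i = 0" if "i < N" for i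
      proof (rule glrr_vanishes[of "2 * p" "2 * r" "\<lambda>i. self_convolution r a $ i" N "\<lambda>i. w $ i"])
        fix k assume "k < N - 2 * r"
        then show "(\<Sum>i\<le>2 * r. self_convolution r a $ i * w $ (k + i)) = 0"
          using w by (simp add: self_convolution_sum[of r a "\<lambda>i. w $ i"]
            glrr_space_self_convolution_iff[OF \<open>2 * r < N\<close>])
      next
        fix k assume "k < 2 * p"
        then show "w $ k = 0" using out[of k] p by simp
      next
        fix k assume "N - 2 * r + 2 * p \<le> k" "k < N"
        then have "k - (N - 2 * r) < 2 * r" "k - (N - 2 * r) + (N - 2 * r) = k" "\<not> k - (N - 2 * r) < 2 * p"
          using \<open>2 * r < N\<close> by auto
        then show "w $ k = 0" using out[of "k - (N - 2 * r)"] by simp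
      qed (use p top that self_convolution_top[OF p(1) top] in auto)
      then show ?thesis using wc by (intro eq_vecI) auto
    qed
    let ?row = "\<lambda>k. if k < 2 * p then k else k + (N - 2 * r)"
    have rowN: "?row k < N" if "k < 2 * r" for k using that p \<open>2 * r < N\<close> by auto
    let ?R = "mat (2 * r) (2 * r) (\<lambda>(k, j). J $$ (?row k, j))"
    have R: "?R \<in> carrier_mat (2 * r) (2 * r)" by simp
    have Rv: "(?R *\<^sub>v v) $ k = (J *\<^sub>v v) $ ?row k" if "v \<in> carrier_vec (2 * r)" "k < 2 * r" for v k
    proof -
      have "(?R *\<^sub>v v) $ k = (\<Sum>j<2 * r. ?R $$ (k, j) * v $ j)"
        by (rule mult_mat_vec_index_sum[OF R that])
      also have "\<dots> = (\<Sum>j<2 * r. J $$ (?row k, j) * v $ j)"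
        using that by (intro sum.cong refl) simp
      also have "\<dots> = (J *\<^sub>v v) $ ?row k"
        by (rule Jv[OF that(1) rowN[OF that(2)], symmetric])
      finally show ?thesis .
    qed
    \<comment> \<open>If the selected rows of \<open>J *\<^sub>v v\<close> vanish, so does the whole
      vector, as it lies in Z(a^2); then \<open>ker\<close> applies.\<close>
    have "v = 0\<^sub>v (2 * r)" if v: "v \<in> carrier_vec (2 * r)" and 0: "?R *\<^sub>v v = 0\<^sub>v (2 * r)" for v
    proof (rule ker[OF v vanish[OF im[OF v]]])
      fix k assume "k < 2 * r"
      then show "(J *\<^sub>v v) $ ?row k = 0" using Rv[OF v, of k] unfolding 0 by (simp only: index_zero_vec)
    qed
    then have "det ?R \<noteq> 0" using det_0_iff_vec_prod_zero_field[OF R] by blast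
    then obtain v where v: "v \<in> carrier_vec (2 * r)" "?R *\<^sub>v v = vec (2 * r) (\<lambda>k. z $ ?row k)"
      using det_nonzero_imp_solution[OF R, of "vec (2 * r) (\<lambda>k. z $ ?row k)"] by auto
    have zc: "z \<in> carrier_vec N" using z by (simp add: glrr_space_def)
    have Jvc: "J *\<^sub>v v \<in> carrier_vec N" using J v by auto
    have dist: "(\<Sum>i\<le>r. a $ i * (\<Sum>l\<le>r. a $ l * (J *\<^sub>v v - z) $ (k + i + l)))
        = (\<Sum>i\<le>r. a $ i * (\<Sum>l\<le>r. a $ l * (J *\<^sub>v v) $ (k + i + l)))
          - (\<Sum>i\<le>r. a $ i * (\<Sum>l\<le>r. a $ l * z $ (k + i + l)))" if "k < N - 2 * r" for k
    proof -
      have "(J *\<^sub>v v - z) $ (k + i + l) = (J *\<^sub>v v) $ (k + i + l) - z $ (k + i + l)"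
        if "i \<le> r" "l \<le> r" for i l
        using that \<open>k < N - 2 * r\<close> zc by (intro index_minus_vec) auto
      then have "(\<Sum>i\<le>r. a $ i * (\<Sum>l\<le>r. a $ l * (J *\<^sub>v v - z) $ (k + i + l)))
          = (\<Sum>i\<le>r. a $ i * (\<Sum>l\<le>r. a $ l * ((J *\<^sub>v v) $ (k + i + l) - z $ (k + i + l))))"
        by (intro sum.cong refl arg_cong2[where f = "(*)"]) (simp only: atMost_iff)
      then show ?thesis by (simp only: right_diff_distrib sum_subtractf)
    qed
    have "J *\<^sub>v v - z = 0\<^sub>v N"
    proof (rule vanish)
      show "J *\<^sub>v v - z \<in> glrr_space N (self_convolution r a)"
        using im[OF v(1)] z dist zc Jvc
        by (simp add: glrr_space_self_convolution_iff[OF \<open>2 * r < N\<close>])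
      fix k assume k: "k < 2 * r"
      have "(J *\<^sub>v v) $ ?row k = z $ ?row k" using Rv[OF v(1) k] k unfolding v(2) by simp
      moreover have "(J *\<^sub>v v - z) $ ?row k = (J *\<^sub>v v) $ ?row k - z $ ?row k"
        by (rule index_minus_vec) (use rowN[OF k] zc in simp)
      ultimately show "(J *\<^sub>v v - z) $ ?row k = 0" by simp
    qed
    then have "(J *\<^sub>v v) $ i = z $ i" if "i < N" for i
    proof -
      have "(J *\<^sub>v v - z) $ i = (J *\<^sub>v v) $ i - z $ i" using that zc by (intro index_minus_vec) simp
      then show ?thesis using \<open>J *\<^sub>v v - z = 0\<^sub>v N\<close> that by simp
    qed
    then have "z = J *\<^sub>v v" by (intro eq_vecI) (use zc Jvc in \<open>simp_all only: carrier_vecD\<close>)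
    then show "z \<in> (\<lambda>v. J *\<^sub>v v) ` carrier_vec (2 * r)" using v(1) by blast
  qed
  have "col_space J = (\<lambda>v. J *\<^sub>v v) ` carrier_vec (2 * r)"
    using col_space_eq[OF J] J by auto
  then show "col_space J = glrr_space N (self_convolution r a)"
    unfolding \<open>col_space J = _\<close> using im by (intro subset_antisym sub) auto
qed

theorem theorem2p3:
  fixes N r :: nat and S a :: "real vec"
  assumes "1 \<le> r" and "2 * r < N"
    and "S \<in> rank_series N r"
    and "a \<in> carrier_vec (r + 1)" and "a \<noteq> 0\<^sub>v (r + 1)"
    and "governed a S"
  shows "(\<exists>V. is_tangent_subspace N r S V) \<and>
    (\<forall>V. is_tangent_subspace N r S V \<longrightarrow>
       subspace_dim N V = 2 * r \<and> V = glrr_space N (self_convolution r a))"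
proof (intro conjI allI impI)
  have "r < N" using assms(2) by simp
  have a: "a \<in> carrier_vec (Suc r)" "a \<noteq> 0\<^sub>v (Suc r)" using assms(4,5) by simp_all
  show "\<exists>V. is_tangent_subspace N r S V"
    by (rule is_tangent_subspace_exists[OF assms(3) \<open>r < N\<close> a assms(6)])
  fix V assume "is_tangent_subspace N r S V"
  then obtain \<tau> b x J where \<tau>: "\<tau> \<le> r" and b: "b \<in> carrier_vec (Suc r)" "b $ \<tau> = -1" "governed b S"
    and x: "x = subvec S (index_I N r \<tau>) @\<^sub>v subvec b (index_K r \<tau>)"
    and near: "S_map_defined_near N r \<tau> x"
    and jac: "has_jacobian N (2 * r) (S_map N r \<tau>) J x"
    and V: "V = vec_space.col_space N J"
    unfolding is_tangent_subspace_def by (auto simp: less_Suc_eq_le)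
  note eq = tangent_subspace_eq_glrr_space[OF assms(3,2) \<tau> b x near jac]
  show "subspace_dim N V = 2 * r" unfolding V by (rule eq(1))
  \<comment> \<open>\<open>V\<close> may stem from any admissible \<open>\<tau>\<close> and
    normalized \<open>b\<close>. Uniqueness of the recurrence up to scaling leads back to
    \<open>a\<close>, which also shows that all choices give the same space.\<close>
  obtain c where c: "b = c \<cdot>\<^sub>v a"
    using governed_unique_up_to_scaling[OF assms(3) \<open>r < N\<close> a assms(6) b(1,3)] by blast
  have "c \<noteq> 0" using b(2) \<tau> a(1) by (auto simp: c)
  then show "V = glrr_space N (self_convolution r a)"
    unfolding V eq(2) c by (rule glrr_space_self_convolution_smult[OF assms(2) a(1)])
qed

end
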